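(* Let $(X,\kappa)$ be a Lefschetz complex, $\mathcal V$ a combinatorial multivector field on $X$ such that $X$ is invariant, and let $S\subseteq X$ be an isolated invariant set. Let $\mathcal M=\{M_r: r\in\mathbb P\}$ be a Morse decomposition of $S$. Put $c_k(T):=\operatorname{rank}H^\kappa_k(T)$ for an isolated invariant set $T$ and $m_k(\mathcal M):=\sum_{r\in\mathbb P}c_k(M_r)$. Then for every integer $k\ge 0$: (i) (strong Morse inequalities) $\displaystyle\sum_{j=0}^{k}(-1)^{k-j}m_j(\mathcal M)\ \ge\ \sum_{j=0}^{k}(-1)^{k-j}c_j(S)$; (ii) (weak Morse inequalities) $m_k(\mathcal M)\ge c_k(S)$.
   Context: Fix a ring $R$ with unity; $\operatorname{rank}$ denotes the rank of a finitely generated $R$-module. A Lefschetz complex $(X,\kappa)$ is a finite set $X=\bigsqcup_{q\ge 0}X_q$ graded by non-negative integers with a map $\kappa:X\times X\to R$ such that $\kappa(x,y)\ne 0$ implies $x\in X_q$, $y\in X_{q-1}$ for some $q$, and $\sum_{y\in X}\kappa(x,y)\kappa(y,z)=0$ for all $x,z\in X$. Let $\le_\kappa$ be the smallest partial order on $X$ with $y\le_\kappa x$ whenever $\kappa(x,y)\neq 0$. $X$ carries the topology whose open sets are the upper sets of $\le_\kappa$, so $\operatorname{cl}A=\{y\in X: y\le_\kappa x\text{ for some }x\in A\}$; $\operatorname{cl}x=\operatorname{cl}\{x\}$, $\operatorname{mo}A:=\operatorname{cl}A\setminus A$. A set $A$ is proper if $\operatorname{mo}A$ is closed. The Lefschetz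 homology $H^\kappa(X)$ is the homology of the free chain complex $R(X)$ with basis $X$ and $\partial x=\sum_y\kappa(x,y)y$. A proper $A\subseteq X$ with $\kappa|_{A\times A}$ is again a Lefschetz complex, with homology $H^\kappa(A)$. A multivector is a proper $V\subseteq X$ with a unique maximal element $V^\star$ with respect to $\le_\kappa$; it is regular if $H^\kappa(V)=0$ and critical otherwise. A combinatorial multivector field $\mathcal V$ on $X$ is a partition of $X$ into multivectors; $[x]$ is the multivector containing $x$ and $x^\star:=[x]^\star$. Define $\Pi_{\mathcal V}:X\to\mathcal P(X)$ by: $y\in\Pi_{\mathcal V}(x)$ iff (a) $x\ne y=x^\star$, or (b) $x=x^\star$ and $y\in\operatorname{cl}x\setminus[x]$, or (c) $x=x^\star=y$ and $[x]$ is critical. A solution is a map $\varphi$ from an interval of $\mathbb Z$ to $X$ with $\varphi(i+1)\in\Pi_{\mathcal V}(\varphi(i))$ whenever $i,i+1$ are in the interval; it is full if the interval is $\mathbb Z$, and it is a path (from its value at the left end to its value at the right end) if the interval is finite. $\operatorname{Sol}(x,A)$ is the set of full solutions with values in $A$ and with $x$ among their values. $A$ is $\mathcal V$-compatible if $x\in A$ implies $[x]\subseteq A$; $[A]_{\mathcal V}^-$ (resp. $[A]_{\mathcal V}^+$) is the largest $\mathcal V$-compatible subset (resp. smallest $\mathcal V$-compatible superset) of $A$. $\operatorname{Inv}A:=\{x\in A:\operatorname{Sol}(x^\star,[A]_{\mathcal V}^-)\ne\emptyset\}$; $A$ is invariant if $\operatorname{Inv}A=A$ (invariant sets are $\mathcal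 V$-compatible). An internal tangency of an invariant set $A$ is a path $\varphi$ from some $x\in A$ to some $y\in A$ with $\operatorname{im}\varphi\subseteq\operatorname{cl}A$ and $\operatorname{im}\varphi\cap\operatorname{mo}A\ne\emptyset$. An isolated invariant set is an invariant set that admits no internal tangencies. For a full solution $\varphi$: $\alpha(\varphi)=\bigcap_{k\ge0}\operatorname{Inv}[\{\varphi(i):i\le -k\}]^+_{\mathcal V}$, $\omega(\varphi)=\bigcap_{k\ge0}\operatorname{Inv}[\{\varphi(i):i\ge k\}]^+_{\mathcal V}$. A family $\{M_r\}_{r\in\mathbb P}$ indexed by a finite set $\mathbb P$ is a Morse decomposition of $X$ if there is a partial order $\le$ on $\mathbb P$ such that: (i) the $M_r$ are mutually disjoint isolated invariant subsets of $X$; (ii) for every full solution $\varphi$ in $X$ there are $r\le r'$ in $\mathbb P$ with $\alpha(\varphi)\subseteq M_{r'}$, $\omega(\varphi)\subseteq M_r$; (iii) if $\alpha(\varphi)\cup\omega(\varphi)\subseteq M_r$ for a full solution $\varphi$ and $r\in\mathbb P$, then $\operatorname{im}\varphi\subseteq M_r$. The source states that an invariant set is isolated invariant if and only if it is proper; on this basis an isolated invariant set $S$ is regarded as a Lefschetz complex $(S,\kappa|_{S\times S})$ with the combinatorial multivector field $\mathcal V|_S=\{V\in\mathcal V:V\subseteq S\}$. A Morse decomposition of $S$ means a Morse decomposition with $(S,\mathcal V|_S)$ in place of $(X,\mathcal V)$.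
   Formalization: The ring R is taken to be a domain satisfying the left Ore condition (e.g. any commutative integral domain), with rank the maximal number of linearly independent elements, and it is assumed that S with restricted κ is a Lefschetz complex; without these the claim fails or is undefined. *)

theory Defs
  imports
    "HOL-Analysis.Abstract_Topology"
    "HOL-Library.Disjoint_Sets"
    "HOL-Algebra.AbelCoset"
    "HOL-Algebra.Module"
begin

section \<open>Rank and quotients of left modules over a type-class ring\<close>

text \<open>Scalars come from a type of class \<^class>\<open>ring_1\<close>, not necessarily commutative, so only the
  record of \<^theory>\<open>HOL-Algebra.Module\<close> is used and not its locale, which requires a commutative
  ring. The fields for multiplication and unit of the record play no role.\<close>

definition lin_indep_family ::
    "('r::ring_1, 'm, 'z) module_scheme \<Rightarrow> nat \<Rightarrow> (nat \<Rightarrow> 'm) \<Rightarrow> bool" where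
  "lin_indep_family M n f \<longleftrightarrow>
     f ` {..<n} \<subseteq> carrier M \<and>
     (\<forall>a. finsum M (\<lambda>i. a i \<odot>\<^bsub>M\<^esub> f i) {..<n} = \<zero>\<^bsub>M\<^esub> \<longrightarrow> (\<forall>i<n. a i = 0))"

text \<open>The largest number of linearly independent elements. For a subquotient of a finitely
  generated module over a left Ore domain these numbers are bounded; where they are unbounded
  the value is meaningless. Over a commutative domain this is the dimension over the field of
  fractions.\<close>

definition module_rank :: "('r::ring_1, 'm, 'z) module_scheme \<Rightarrow> nat" where
  "module_rank M = (GREATEST n. \<exists>f. lin_indep_family M n f)"

text \<open>The quotient of the submodule with carrier \<open>Z\<close> of \<open>C\<close> by the submodule with carrier \<open>B\<close>.\<close>

definition subquotient ::
    "('r, 'm, 'z) module_scheme \<Rightarrow> 'm set \<Rightarrow> 'm set \<Rightarrow> ('r, 'm set) module" where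
  "subquotient C Z B =
     \<lparr>carrier = (\<lambda>z. B +>\<^bsub>C\<^esub> z) ` Z, mult = undefined, one = undefined,
      zero = B, add = (<+>\<^bsub>C\<^esub>),
      smult = (\<lambda>a K. \<Union>z\<in>K. B +>\<^bsub>C\<^esub> (a \<odot>\<^bsub>C\<^esub> z))\<rparr>"


section \<open>Lefschetz complexes\<close>

text \<open>The gradation \<open>X = \<Squnion>\<^sub>q X\<^sub>q\<close> is given by the function \<open>grade\<close>, with
  \<open>X\<^sub>q = {x \<in> X. grade x = q}\<close>. No definition below inspects \<open>grade\<close> or \<open>coef\<close> outside of
  \<open>cells\<close>; hence passing to \<open>A \<subseteq> X\<close> with \<open>\<kappa>\<close> restricted to \<open>A \<times> A\<close> only changes \<open>cells\<close>.\<close>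

record ('a, 'r) lcomplex =
  cells :: "'a set"
  grade :: "'a \<Rightarrow> nat"
  coef :: "'a \<Rightarrow> 'a \<Rightarrow> 'r"  (\<open>\<kappa>\<index>\<close>)

definition lefschetz_complex :: "('a, 'r::ring_1) lcomplex \<Rightarrow> bool" where
  "lefschetz_complex L \<longleftrightarrow>
     finite (cells L) \<and>
     (\<forall>x\<in>cells L. \<forall>y\<in>cells L. \<kappa>\<^bsub>L\<^esub> x y \<noteq> 0 \<longrightarrow> grade L x = Suc (grade L y)) \<and>
     (\<forall>x\<in>cells L. \<forall>z\<in>cells L. (\<Sum>y\<in>cells L. \<kappa>\<^bsub>L\<^esub> x y * \<kappa>\<^bsub>L\<^esub> y z) = 0)"

definition subcomplex :: "('a, 'r) lcomplex \<Rightarrow> 'a set \<Rightarrow> ('a, 'r) lcomplex"  (infixl \<open>\<restriction>\<close> 75) where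
  "L \<restriction> A = L\<lparr>cells := A\<rparr>"

text \<open>The pair \<open>(y, x)\<close> is in \<open>face_order L\<close> iff \<open>y \<le>\<^sub>\<kappa> x\<close>.\<close>

definition face_order :: "('a, 'r::zero) lcomplex \<Rightarrow> 'a rel" where
  "face_order L =
     \<Inter>{R. partial_order_on (cells L) R \<and>
          (\<forall>x\<in>cells L. \<forall>y\<in>cells L. \<kappa>\<^bsub>L\<^esub> x y \<noteq> 0 \<longrightarrow> (y, x) \<in> R)}"

definition face_topology :: "('a, 'r::zero) lcomplex \<Rightarrow> 'a topology" where
  "face_topology L =
     topology (\<lambda>U. U \<subseteq> cells L \<and> (\<forall>y\<in>U. \<forall>x. (y, x) \<in> face_order L \<longrightarrow> x \<in> U))"

definition cl :: "('a, 'r::zero) lcomplex \<Rightarrow> 'a set \<Rightarrow> 'a set" where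
  "cl L A = Abstract_Topology.closure_of (face_topology L) A"

definition mo :: "('a, 'r::zero) lcomplex \<Rightarrow> 'a set \<Rightarrow> 'a set" where
  "mo L A = cl L A - A"

definition proper_set :: "('a, 'r::zero) lcomplex \<Rightarrow> 'a set \<Rightarrow> bool" where
  "proper_set L A \<longleftrightarrow> A \<subseteq> cells L \<and> closedin (face_topology L) (mo L A)"

lemma openin_face_topology:
  "openin (face_topology L) U \<longleftrightarrow>
     U \<subseteq> cells L \<and> (\<forall>y\<in>U. \<forall>x. (y, x) \<in> face_order L \<longrightarrow> x \<in> U)"
proof -
  have "istopology (\<lambda>U. U \<subseteq> cells L \<and> (\<forall>y\<in>U. \<forall>x. (y, x) \<in> face_order L \<longrightarrow> x \<in> U))"
    unfolding istopology_def by blast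
  then show ?thesis
    unfolding face_topology_def by simp
qed

lemma face_orderI:
  "\<lbrakk>x \<in> cells L; y \<in> cells L; \<kappa>\<^bsub>L\<^esub> x y \<noteq> 0\<rbrakk> \<Longrightarrow> (y, x) \<in> face_order L"
  unfolding face_order_def by blast

lemma partial_order_on_face_order:
  assumes "lefschetz_complex L"
  shows "partial_order_on (cells L) (face_order L)"
proof -
  let ?\<R> = "{R. partial_order_on (cells L) R \<and>
    (\<forall>x\<in>cells L. \<forall>y\<in>cells L. \<kappa>\<^bsub>L\<^esub> x y \<noteq> 0 \<longrightarrow> (y, x) \<in> R)}"
  let ?G = "{(y, x). y \<in> cells L \<and> x \<in> cells L \<and> (y = x \<or> grade L y < grade L x)}"
  have "partial_order_on (cells L) ?G"
    unfolding partial_order_on_def preorder_on_def refl_on_def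
    by (auto simp: trans_def antisym_def)
  then have G: "?G \<in> ?\<R>"
    using assms unfolding lefschetz_complex_def by auto
  have po: "partial_order_on (cells L) R" if "R \<in> ?\<R>" for R
    using that by simp
  have "face_order L \<subseteq> cells L \<times> cells L"
    using Inter_lower[OF G] unfolding face_order_def by fastforce
  moreover have "refl_on (cells L) (face_order L)"
    unfolding face_order_def refl_on_def
    using partial_order_onD(1)[OF po, unfolded refl_on_def] by (intro ballI InterI) simp
  moreover have "trans (face_order L)"
  proof (rule transI)
    fix x y z assume "(x, y) \<in> face_order L" "(y, z) \<in> face_order L"
    then show "(x, z) \<in> face_order L"
      unfolding face_order_def using transD[OF partial_order_onD(2)[OF po]] by (meson InterE InterI)
  qed
  moreover have "antisym (face_order L)"
  proof (rule antisym_subset)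
    show "face_order L \<subseteq> ?G"
      unfolding face_order_def using G by (rule Inter_lower)
    show "antisym ?G"
      using po[OF G] by (rule partial_order_onD(3))
  qed
  ultimately show ?thesis
    unfolding partial_order_on_def preorder_on_def by blast
qed

lemma topspace_face_topology:
  assumes "lefschetz_complex L"
  shows "topspace (face_topology L) = cells L"
proof (rule antisym)
  show "topspace (face_topology L) \<subseteq> cells L"
    using openin_topspace[of "face_topology L"] unfolding openin_face_topology by blast
  have "openin (face_topology L) (cells L)"
    using partial_order_on_face_order[OF assms]
    unfolding openin_face_topology partial_order_on_def preorder_on_def by blast
  then show "cells L \<subseteq> topspace (face_topology L)"
    by (rule openin_subset)
qed

lemma cl_eq:
  assumes "lefschetz_complex L" "A \<subseteq> cells L"
  shows "cl L A = {y \<in> cells L. \<exists>x\<in>A. (y, x) \<in> face_order L}"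
proof -
  note po = partial_order_on_face_order[OF assms(1)]
  have up: "openin (face_topology L) {x. (y, x) \<in> face_order L}" for y
    unfolding openin_face_topology
    using partial_order_onD(4)[OF po] transD[OF partial_order_onD(2)[OF po]] by auto
  show ?thesis
  proof (intro antisym subsetI)
    fix y assume y: "y \<in> cl L A"
    then have yc: "y \<in> cells L"
      unfolding cl_def in_closure_of topspace_face_topology[OF assms(1)] by simp
    then have "y \<in> {x. (y, x) \<in> face_order L}"
      using partial_order_onD(1)[OF po] unfolding refl_on_def by simp
    then obtain x where "x \<in> A" "x \<in> {x. (y, x) \<in> face_order L}"
      using y up[of y] unfolding cl_def in_closure_of by meson
    then show "y \<in> {y \<in> cells L. \<exists>x\<in>A. (y, x) \<in> face_order L}"
      using yc by auto
  next
    fix y assume "y \<in> {y \<in> cells L. \<exists>x\<in>A. (y, x) \<in> face_order L}"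
    then show "y \<in> cl L A"
      unfolding cl_def in_closure_of topspace_face_topology[OF assms(1)] openin_face_topology
      by auto
  qed
qed

lemma proper_imp_lefschetz_complex:
  assumes L: "lefschetz_complex L" and A: "proper_set L A"
  shows "lefschetz_complex (L \<restriction> A)"
proof -
  have sub: "A \<subseteq> cells L" and mo: "closedin (face_topology L) (mo L A)"
    using A unfolding proper_set_def by auto
  have fin: "finite (cells L)"
    using L unfolding lefschetz_complex_def by blast
  have zero: "\<kappa>\<^bsub>L\<^esub> x y * \<kappa>\<^bsub>L\<^esub> y z = 0"
    if "x \<in> A" "z \<in> A" "y \<in> cells L - A" for x y z
  proof (rule ccontr)
    assume "\<kappa>\<^bsub>L\<^esub> x y * \<kappa>\<^bsub>L\<^esub> y z \<noteq> 0"
    then have nz: "\<kappa>\<^bsub>L\<^esub> x y \<noteq> 0" "\<kappa>\<^bsub>L\<^esub> y z \<noteq> 0" by auto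
    have le: "(y, x) \<in> face_order L" "(z, y) \<in> face_order L"
      using nz that sub by (auto intro!: face_orderI)
    have "y \<in> mo L A"
      using le that unfolding mo_def cl_eq[OF L sub] by blast
    moreover have "cl L (mo L A) = mo L A"
      using mo unfolding cl_def by (simp add: closure_of_closedin)
    moreover have "mo L A \<subseteq> cells L"
      unfolding mo_def cl_eq[OF L sub] by blast
    ultimately have "z \<in> mo L A"
      using le that sub cl_eq[OF L, of "mo L A"] by blast
    then show False
      using that unfolding mo_def by blast
  qed
  have "(\<Sum>y\<in>A. \<kappa>\<^bsub>L\<^esub> x y * \<kappa>\<^bsub>L\<^esub> y z) = 0" if "x \<in> A" "z \<in> A" for x z
  proof -
    have "(\<Sum>y\<in>A. \<kappa>\<^bsub>L\<^esub> x y * \<kappa>\<^bsub>L\<^esub> y z) = (\<Sum>y\<in>cells L. \<kappa>\<^bsub>L\<^esub> x y * \<kappa>\<^bsub>L\<^esub> y z)"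
      using fin sub zero[OF that] by (intro sum.mono_neutral_left) auto
    also have "\<dots> = 0"
      using L that sub unfolding lefschetz_complex_def by blast
    finally show ?thesis .
  qed
  moreover have "grade L x = Suc (grade L y)" if "x \<in> A" "y \<in> A" "\<kappa>\<^bsub>L\<^esub> x y \<noteq> 0" for x y
    using L that sub unfolding lefschetz_complex_def by blast
  ultimately show ?thesis
    using finite_subset[OF sub fin] unfolding lefschetz_complex_def subcomplex_def by simp
qed

text \<open>\<open>chain_module L k\<close> is the degree \<open>k\<close> part of the free left module with basis \<open>cells L\<close>;
  a chain \<open>\<Sum>\<^sub>x c\<^sub>x x\<close> is represented by its coefficient function.\<close>

definition chain_module :: "('a, 'r::ring_1) lcomplex \<Rightarrow> nat \<Rightarrow> ('r, 'a \<Rightarrow> 'r) module" where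
  "chain_module L k =
     \<lparr>carrier = {c. \<forall>x. c x \<noteq> 0 \<longrightarrow> x \<in> cells L \<and> grade L x = k},
      mult = undefined, one = undefined,
      zero = (\<lambda>x. 0), add = (\<lambda>c d x. c x + d x), smult = (\<lambda>a c x. a * c x)\<rparr>"

definition boundary :: "('a, 'r::ring_1) lcomplex \<Rightarrow> ('a \<Rightarrow> 'r) \<Rightarrow> 'a \<Rightarrow> 'r" where
  "boundary L c = (\<lambda>y. if y \<in> cells L then \<Sum>x\<in>cells L. c x * \<kappa>\<^bsub>L\<^esub> x y else 0)"

definition homology :: "('a, 'r::ring_1) lcomplex \<Rightarrow> nat \<Rightarrow> ('r, ('a \<Rightarrow> 'r) set) module" where
  "homology L k =
     subquotient (chain_module L k)
       {c \<in> carrier (chain_module L k). boundary L c = (\<lambda>y. 0)}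
       (boundary L ` carrier (chain_module L (Suc k)))"


section \<open>Combinatorial multivector fields\<close>

definition maximal_in :: "('a, 'r::zero) lcomplex \<Rightarrow> 'a set \<Rightarrow> 'a \<Rightarrow> bool" where
  "maximal_in L V v \<longleftrightarrow> v \<in> V \<and> (\<forall>w\<in>V. (v, w) \<in> face_order L \<longrightarrow> w = v)"

definition multivector :: "('a, 'r::zero) lcomplex \<Rightarrow> 'a set \<Rightarrow> bool" where
  "multivector L V \<longleftrightarrow> proper_set L V \<and> (\<exists>!v. maximal_in L V v)"

definition regular :: "('a, 'r::ring_1) lcomplex \<Rightarrow> 'a set \<Rightarrow> bool" where
  "regular L V \<longleftrightarrow> (\<forall>k. carrier (homology (L \<restriction> V) k) = {\<zero>\<^bsub>homology (L \<restriction> V) k\<^esub>})"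

definition multivector_field :: "('a, 'r::zero) lcomplex \<Rightarrow> 'a set set \<Rightarrow> bool" where
  "multivector_field L \<V> \<longleftrightarrow> partition_on (cells L) \<V> \<and> (\<forall>V\<in>\<V>. multivector L V)"

text \<open>\<open>mv \<V> x\<close> is \<open>[x]\<close> and \<open>star L \<V> x\<close> is \<open>x\<^sup>\<star>\<close>.\<close>

definition mv :: "'a set set \<Rightarrow> 'a \<Rightarrow> 'a set" where
  "mv \<V> x = (THE V. V \<in> \<V> \<and> x \<in> V)"

definition star :: "('a, 'r::zero) lcomplex \<Rightarrow> 'a set set \<Rightarrow> 'a \<Rightarrow> 'a" where
  "star L \<V> x = (THE v. maximal_in L (mv \<V> x) v)"

definition mv_map :: "('a, 'r::ring_1) lcomplex \<Rightarrow> 'a set set \<Rightarrow> 'a \<Rightarrow> 'a set"  (\<open>\<Pi>\<close>) where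
  "\<Pi> L \<V> x =
     {y \<in> cells L.
        (x \<noteq> y \<and> y = star L \<V> x) \<or>
        (x = star L \<V> x \<and> y \<in> cl L {x} - mv \<V> x) \<or>
        (x = star L \<V> x \<and> y = x \<and> \<not> regular L (mv \<V> x))}"


section \<open>Solutions, invariant sets, Morse decompositions\<close>

text \<open>Only the values of \<open>\<phi>\<close> on the interval \<open>I\<close> are relevant.\<close>

definition solution ::
    "('a, 'r::ring_1) lcomplex \<Rightarrow> 'a set set \<Rightarrow> int set \<Rightarrow> (int \<Rightarrow> 'a) \<Rightarrow> bool" where
  "solution L \<V> I \<phi> \<longleftrightarrow>
     \<phi> ` I \<subseteq> cells L \<and> (\<forall>i. i \<in> I \<and> i + 1 \<in> I \<longrightarrow> \<phi> (i + 1) \<in> \<Pi> L \<V> (\<phi> i))"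

abbreviation full_solution ::
    "('a, 'r::ring_1) lcomplex \<Rightarrow> 'a set set \<Rightarrow> (int \<Rightarrow> 'a) \<Rightarrow> bool" where
  "full_solution L \<V> \<phi> \<equiv> solution L \<V> UNIV \<phi>"

definition Sol :: "('a, 'r::ring_1) lcomplex \<Rightarrow> 'a set set \<Rightarrow> 'a \<Rightarrow> 'a set \<Rightarrow> (int \<Rightarrow> 'a) set" where
  "Sol L \<V> x A = {\<phi>. full_solution L \<V> \<phi> \<and> range \<phi> \<subseteq> A \<and> x \<in> range \<phi>}"

definition compatible :: "('a, 'r) lcomplex \<Rightarrow> 'a set set \<Rightarrow> 'a set \<Rightarrow> bool" where
  "compatible L \<V> A \<longleftrightarrow> A \<subseteq> cells L \<and> (\<forall>x\<in>A. mv \<V> x \<subseteq> A)"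

definition compat_interior :: "('a, 'r) lcomplex \<Rightarrow> 'a set set \<Rightarrow> 'a set \<Rightarrow> 'a set" where
  "compat_interior L \<V> A = \<Union>{B. compatible L \<V> B \<and> B \<subseteq> A}"

definition compat_hull :: "('a, 'r) lcomplex \<Rightarrow> 'a set set \<Rightarrow> 'a set \<Rightarrow> 'a set" where
  "compat_hull L \<V> A = \<Inter>{B. compatible L \<V> B \<and> A \<subseteq> B}"

definition Inv :: "('a, 'r::ring_1) lcomplex \<Rightarrow> 'a set set \<Rightarrow> 'a set \<Rightarrow> 'a set" where
  "Inv L \<V> A = {x \<in> A. Sol L \<V> (star L \<V> x) (compat_interior L \<V> A) \<noteq> {}}"

definition invariant :: "('a, 'r::ring_1) lcomplex \<Rightarrow> 'a set set \<Rightarrow> 'a set \<Rightarrow> bool" where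
  "invariant L \<V> A \<longleftrightarrow> A \<subseteq> cells L \<and> Inv L \<V> A = A"

definition internal_tangency ::
    "('a, 'r::ring_1) lcomplex \<Rightarrow> 'a set set \<Rightarrow> 'a set \<Rightarrow> int \<Rightarrow> int \<Rightarrow> (int \<Rightarrow> 'a) \<Rightarrow> bool" where
  "internal_tangency L \<V> A a b \<phi> \<longleftrightarrow>
     a \<le> b \<and> solution L \<V> {a..b} \<phi> \<and> \<phi> a \<in> A \<and> \<phi> b \<in> A \<and>
     \<phi> ` {a..b} \<subseteq> cl L A \<and> \<phi> ` {a..b} \<inter> mo L A \<noteq> {}"

definition isolated_invariant :: "('a, 'r::ring_1) lcomplex \<Rightarrow> 'a set set \<Rightarrow> 'a set \<Rightarrow> bool" where
  "isolated_invariant L \<V> A \<longleftrightarrow>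
     invariant L \<V> A \<and> (\<nexists>a b \<phi>. internal_tangency L \<V> A a b \<phi>)"

definition alpha_limit ::
    "('a, 'r::ring_1) lcomplex \<Rightarrow> 'a set set \<Rightarrow> (int \<Rightarrow> 'a) \<Rightarrow> 'a set" where
  "alpha_limit L \<V> \<phi> = (\<Inter>k::nat. Inv L \<V> (compat_hull L \<V> (\<phi> ` {..- int k})))"

definition omega_limit ::
    "('a, 'r::ring_1) lcomplex \<Rightarrow> 'a set set \<Rightarrow> (int \<Rightarrow> 'a) \<Rightarrow> 'a set" where
  "omega_limit L \<V> \<phi> = (\<Inter>k::nat. Inv L \<V> (compat_hull L \<V> (\<phi> ` {int k..})))"

text \<open>In the relation \<open>R\<close>, as in \<^const>\<open>partial_order_on\<close>, \<open>(r, r') \<in> R\<close> means \<open>r \<le> r'\<close>.\<close>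

definition morse_decomposition ::
    "('a, 'r::ring_1) lcomplex \<Rightarrow> 'a set set \<Rightarrow> 'p set \<Rightarrow> ('p \<Rightarrow> 'a set) \<Rightarrow> bool" where
  "morse_decomposition L \<V> P M \<longleftrightarrow>
     finite P \<and>
     (\<exists>R. partial_order_on P R \<and>
        disjoint_family_on M P \<and>
        (\<forall>r\<in>P. isolated_invariant L \<V> (M r)) \<and>
        (\<forall>\<phi>. full_solution L \<V> \<phi> \<longrightarrow>
           (\<exists>r\<in>P. \<exists>r'\<in>P. (r, r') \<in> R \<and>
              alpha_limit L \<V> \<phi> \<subseteq> M r' \<and> omega_limit L \<V> \<phi> \<subseteq> M r)) \<and>
        (\<forall>\<phi>. \<forall>r\<in>P. full_solution L \<V> \<phi> \<and>
           alpha_limit L \<V> \<phi> \<union> omega_limit L \<V> \<phi> \<subseteq> M r \<longrightarrow> range \<phi> \<subseteq> M r))"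

definition betti :: "('a, 'r::ring_1) lcomplex \<Rightarrow> 'a set \<Rightarrow> nat \<Rightarrow> int" where
  "betti L T k = int (module_rank (homology (L \<restriction> T) k))"

definition morse_number ::
    "('a, 'r::ring_1) lcomplex \<Rightarrow> 'p set \<Rightarrow> ('p \<Rightarrow> 'a set) \<Rightarrow> nat \<Rightarrow> int" where
  "morse_number L P M k = (\<Sum>r\<in>P. betti L (M r) k)"

end

theory Submission
  imports Defs
begin

text \<open>Let \<open>b\<^sub>k\<close> be the rank of the boundary map in degree \<open>k\<close>. Since ranks over a left Ore domain are
  additive, the \<open>k\<close>-th Betti number is the number of \<open>k\<close>-cells minus \<open>b\<^sub>k\<close> and \<open>b\<^bsub>k+1\<^esub>\<close>. Now divide the
  cells into the Morse sets and the multivectors outside of all Morse sets; the latter are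
  regular, because the maximal cell of a critical multivector is a constant solution. Collapsing
  the blocks leaves an acyclic relation: a cycle through several blocks would be a periodic
  solution or a chain of connections between Morse sets, against the Morse decomposition. Hence
  the boundary matrices are block triangular, and a block triangular matrix has at least the rank
  of its diagonal. So the excess of the Morse number over the Betti number in degree \<open>k\<close> is
  \<open>d\<^sub>k + d\<^bsub>k+1\<^esub>\<close> with \<open>d\<^sub>k \<ge> 0\<close> and \<open>d\<^sub>0 = 0\<close>, which gives the weak inequality at once and the strong
  one by telescoping.\<close>

section \<open>Ranks over a left Ore domain\<close>

text \<open>In a commutative domain \<open>c = b\<close> and \<open>d = a\<close> serve. In a domain
  where the condition fails, two nonzero left ideals meet in 0, the ring contains free left modules
  of every finite rank, and independent families have no greatest size. Where it holds, it replaces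
  division: a maximal independent family need not span, but it spans a nonzero multiple of each
  element, and such multiples can be brought together.

  The obstacle in the second half is that the Morse sets are not shown to be proper, so that even a
  squared boundary of zero on a Morse set needs an argument. It is drawn, like the triangular shape,
  from one natural number per block that strictly drops along every nonzero coefficient between
  different blocks. To find this number, coefficients are translated into paths of the multivector
  dynamics. A Morse decomposition speaks only of limit sets of full solutions, so paths must be
  completed by rays in both directions, and the limit sets must be shown to meet the sets in which
  the rays end.\<close>

definition left_ore :: "'r::ring_1 itself \<Rightarrow> bool" where
  "left_ore _ \<longleftrightarrow>
     (\<forall>a b :: 'r. a \<noteq> 0 \<longrightarrow> b \<noteq> 0 \<longrightarrow> (\<exists>c d. c * a = d * b \<and> c * a \<noteq> 0))"

text \<open>Gaussian elimination without division, one column at a time. A row and the pivot row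
  \<open>v p\<close> are multiplied from the left so that their entries in column \<open>k\<close>
  agree, and then subtracted. A dependence of the reduced rows pulls back to the original ones; it
  stays nontrivial because the multipliers \<open>c i\<close> are nonzero and there are no zero
  divisors.\<close>

lemma ore_dependent:
  fixes v :: "'i \<Rightarrow> 'j \<Rightarrow> 'r::ring_1_no_zero_divisors"
  assumes ore: "left_ore TYPE('r)"
    and "finite J" "finite I" "card J < card I"
  shows "\<exists>a. (\<exists>i\<in>I. a i \<noteq> 0) \<and> (\<forall>j\<in>J. (\<Sum>i\<in>I. a i * v i j) = 0)"
  using assms(2-4)
proof (induction J arbitrary: I v rule: finite_induct)
  case empty
  then have "I \<noteq> {}"
    by auto
  then show ?case
    by (intro exI[of _ "\<lambda>_. 1"]) auto
next
  case (insert k J)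
  show ?case
  proof (cases "\<forall>i\<in>I. v i k = 0")
    case True
    have "card J < card I"
      using insert.hyps insert.prems by simp
    then show ?thesis
      using insert.IH[of I v] insert.prems True by auto
  next
    case False
    then obtain p where p: "p \<in> I" "v p k \<noteq> 0"
      by auto
    have "\<exists>c d. c \<noteq> 0 \<and> c * v i k = d * v p k" for i
    proof (cases "v i k = 0")
      case True
      then have "1 * v i k = 0 * v p k"
        by simp
      then show ?thesis
        using one_neq_zero by blast
    next
      case False
      then obtain c d where "c * v i k = d * v p k" "c * v i k \<noteq> 0"
        using ore p(2) unfolding left_ore_def by blast
      then show ?thesis
        by (metis mult_zero_left)
    qed
    then obtain c d where cd: "c i \<noteq> 0" "c i * v i k = d i * v p k" for i
      by metis
    let ?I = "I - {p}"
    let ?w = "\<lambda>i j. c i * v i j - d i * v p j"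
    have "card J < card ?I"
      using insert.hyps insert.prems p by simp
    then obtain e where e: "\<exists>i\<in>?I. e i \<noteq> 0" "\<forall>j\<in>J. (\<Sum>i\<in>?I. e i * ?w i j) = 0"
      using insert.IH[of ?I ?w] insert.prems by auto
    \<comment> \<open>The coefficient of the pivot row collects all multiples of it that were
      subtracted from the other rows.\<close>
    let ?a = "\<lambda>i. if i = p then - (\<Sum>i\<in>?I. e i * d i) else e i * c i"
    have a: "(\<Sum>i\<in>I. ?a i * v i j) = (\<Sum>i\<in>?I. e i * ?w i j)" for j
    proof -
      have "(\<Sum>i\<in>I. ?a i * v i j) = ?a p * v p j + (\<Sum>i\<in>?I. ?a i * v i j)"
        using insert.prems(1) p(1) by (rule sum.remove)
      also have "\<dots> = - (\<Sum>i\<in>?I. e i * d i * v p j) + (\<Sum>i\<in>?I. e i * c i * v i j)"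
        by (simp add: sum_distrib_right)
      also have "\<dots> = (\<Sum>i\<in>?I. e i * ?w i j)"
        by (simp add: algebra_simps sum_subtractf)
      finally show ?thesis .
    qed
    have "\<exists>i\<in>I. ?a i \<noteq> 0"
      using e(1) cd(1) by auto
    moreover have "(\<Sum>i\<in>I. ?a i * v i j) = 0" if "j \<in> insert k J" for j
      unfolding a using that e(2) cd(2) by auto
    ultimately show ?thesis
      by (intro exI[of _ ?a] conjI ballI)
  qed
qed

section \<open>Independence and rank modulo a submodule\<close>

definition lincomb :: "nat \<Rightarrow> (nat \<Rightarrow> 'r) \<Rightarrow> (nat \<Rightarrow> 'a \<Rightarrow> 'r::ring_1) \<Rightarrow> 'a \<Rightarrow> 'r" where
  "lincomb n a f = (\<lambda>x. \<Sum>i<n. a i * f i x)"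

definition submod :: "('a \<Rightarrow> 'r::ring_1) set \<Rightarrow> bool" where
  "submod U \<longleftrightarrow> (\<lambda>x. 0) \<in> U \<and> (\<forall>u\<in>U. \<forall>v\<in>U. (\<lambda>x. u x + v x) \<in> U) \<and>
     (\<forall>a. \<forall>u\<in>U. (\<lambda>x. a * u x) \<in> U)"

text \<open>Independence in a quotient, phrased without cosets. \<open>W\<close> may stick out of
  \<open>U\<close>: then it is independence modulo the intersection, which is how
  \<open>boundary_rank_triangular\<close> uses it.\<close>

definition indep_mod ::
    "('a \<Rightarrow> 'r::ring_1) set \<Rightarrow> ('a \<Rightarrow> 'r) set \<Rightarrow> nat \<Rightarrow> (nat \<Rightarrow> 'a \<Rightarrow> 'r) \<Rightarrow> bool" where
  "indep_mod U W n f \<longleftrightarrow> f ` {..<n} \<subseteq> U \<and> (\<forall>a. lincomb n a f \<in> W \<longrightarrow> (\<forall>i<n. a i = 0))"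

definition rank_mod :: "('a \<Rightarrow> 'r::ring_1) set \<Rightarrow> ('a \<Rightarrow> 'r) set \<Rightarrow> nat" where
  "rank_mod U W = (GREATEST n. \<exists>f. indep_mod U W n f)"

text \<open>Makes \<open>U\<close> a set of vectors with finitely many coordinates. Over a left Ore
  domain this bounds the size of independent families, so that the \<open>GREATEST\<close> in
  \<open>rank_mod\<close> is attained.\<close>

definition supported :: "'a set \<Rightarrow> ('a \<Rightarrow> 'r::zero) set \<Rightarrow> bool" where
  "supported X U \<longleftrightarrow> finite X \<and> (\<forall>u\<in>U. \<forall>x. x \<notin> X \<longrightarrow> u x = 0)"

lemma submod_lincomb: "submod U \<Longrightarrow> f ` {..<n} \<subseteq> U \<Longrightarrow> lincomb n a f \<in> U"
proof (induction n)
  case 0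
  then show ?case by (simp add: lincomb_def submod_def)
next
  case (Suc n)
  then have "f ` {..<n} \<subseteq> U" "f n \<in> U"
    by auto
  then have "lincomb n a f \<in> U" "(\<lambda>x. a n * f n x) \<in> U"
    using Suc.IH Suc.prems(1) unfolding submod_def by blast+
  then have "(\<lambda>x. lincomb n a f x + a n * f n x) \<in> U"
    using Suc.prems(1) by (simp add: submod_def)
  then show ?case
    by (simp add: lincomb_def)
qed

lemma submod_diff:
  assumes "submod U" "u \<in> U" "v \<in> U"
  shows "(\<lambda>x. u x - v x) \<in> U"
proof -
  have "(\<lambda>x. - 1 * v x) \<in> U"
    using assms unfolding submod_def by blast
  then have "(\<lambda>x. u x + - 1 * v x) \<in> U"
    using assms(1,2) unfolding submod_def by fast
  then show ?thesis
    by simp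
qed

lemma indep_mod_bound:
  fixes U :: "('a \<Rightarrow> 'r::ring_1_no_zero_divisors) set"
  assumes ore: "left_ore TYPE('r)"
    and X: "supported X U" and W: "(\<lambda>x. 0) \<in> W" and f: "indep_mod U W n f"
  shows "n \<le> card X"
proof (rule ccontr)
  assume "\<not> n \<le> card X"
  then obtain a where a: "\<exists>i\<in>{..<n}. a i \<noteq> 0" "\<forall>x\<in>X. (\<Sum>i<n. a i * f i x) = 0"
    using ore_dependent[OF ore, of X "{..<n}" f] X by (auto simp: supported_def)
  have "lincomb n a f x = 0" for x
  proof (cases "x \<in> X")
    case False
    then have "f i x = 0" if "i < n" for i
      using that f X unfolding indep_mod_def supported_def by blast
    then show ?thesis
      by (simp add: lincomb_def)
  qed (use a in \<open>simp add: lincomb_def\<close>)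
  then have "lincomb n a f = (\<lambda>x. 0)"
    by auto
  then show False
    using f W a(1) unfolding indep_mod_def by auto
qed

lemma rank_mod_ge:
  fixes U :: "('a \<Rightarrow> 'r::ring_1_no_zero_divisors) set"
  assumes ore: "left_ore TYPE('r)"
    and X: "supported X U" and W: "(\<lambda>x. 0) \<in> W" and f: "indep_mod U W n f"
  shows "n \<le> rank_mod U W"
  unfolding rank_mod_def
proof (rule Greatest_le_nat)
  show "\<exists>f. indep_mod U W n f"
    using f by blast
  show "m \<le> card X" if "\<exists>f. indep_mod U W m f" for m
    using that indep_mod_bound[OF ore X W] by blast
qed

lemma rank_mod_witness:
  fixes U :: "('a \<Rightarrow> 'r::ring_1_no_zero_divisors) set"
  assumes ore: "left_ore TYPE('r)"
    and X: "supported X U" and W: "(\<lambda>x. 0) \<in> W"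
  obtains f where "indep_mod U W (rank_mod U W) f"
proof -
  have "\<exists>f. indep_mod U W 0 f"
    by (simp add: indep_mod_def)
  then have "\<exists>f. indep_mod U W (rank_mod U W) f"
    unfolding rank_mod_def by (rule GreatestI_nat) (elim exE, rule indep_mod_bound[OF ore X W])
  then show ?thesis
    using that by blast
qed

lemma rank_mod_le:
  fixes U :: "('a \<Rightarrow> 'r::ring_1_no_zero_divisors) set"
  assumes ore: "left_ore TYPE('r)"
    and X: "supported X U" and W: "(\<lambda>x. 0) \<in> W"
  shows "rank_mod U W \<le> card X"
proof -
  obtain f where "indep_mod U W (rank_mod U W) f"
    by (rule rank_mod_witness[OF ore X W])
  then show ?thesis
    by (rule indep_mod_bound[OF ore X W])
qed

text \<open>Read modulo \<open>W'\<close>, a relation between the joined families loses its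
  \<open>f\<close> part, so the coefficients of \<open>g\<close> vanish; what remains is a relation
  of \<open>f\<close> modulo \<open>W\<close>. This is the source of all lower bounds for ranks
  below, both for additivity and for triangular matrices.\<close>

lemma indep_mod_append:
  assumes f: "indep_mod U W p f" "f ` {..<p} \<subseteq> W'" and g: "indep_mod U W' q g"
    and W': "submod W'" "W \<subseteq> W'"
  shows "indep_mod U W (p + q) (\<lambda>i. if i < p then f i else g (i - p))"
    (is "indep_mod U W _ ?h")
proof -
  have split: "lincomb (p + q) a ?h = (\<lambda>x. lincomb p a f x + lincomb q (\<lambda>i. a (p + i)) g x)" for a
  proof
    fix x
    have "(\<Sum>i\<in>{p..<p + q}. a i * ?h i x) = (\<Sum>i<q. a (p + i) * g i x)"
      by (rule sum.reindex_bij_witness[of _ "\<lambda>i. p + i" "\<lambda>i. i - p"]) auto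
    moreover have "(\<Sum>i<p + q. a i * ?h i x) =
        (\<Sum>i<p. a i * ?h i x) + (\<Sum>i\<in>{p..<p + q}. a i * ?h i x)"
      using sum.atLeastLessThan_concat[of 0 p "p + q" "\<lambda>i. a i * ?h i x"]
      by (simp only: lessThan_atLeast0 le_add1 zero_le)
    moreover have "(\<Sum>i<p. a i * ?h i x) = (\<Sum>i<p. a i * f i x)"
      by (intro sum.cong) auto
    ultimately show "lincomb (p + q) a ?h x = lincomb p a f x + lincomb q (\<lambda>i. a (p + i)) g x"
      by (simp only: lincomb_def)
  qed
  have "a i = 0" if a: "lincomb (p + q) a ?h \<in> W" and i: "i < p + q" for a i
  proof -
    have "(\<lambda>x. lincomb (p + q) a ?h x - lincomb p a f x) \<in> W'"
      using a W' submod_lincomb[OF W'(1) f(2)] by (intro submod_diff) auto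
    then have "lincomb q (\<lambda>i. a (p + i)) g \<in> W'"
      by (simp add: split)
    then have 0: "a (p + i) = 0" if "i < q" for i
      using g that unfolding indep_mod_def by (metis (no_types, lifting))
    then have "lincomb p a f \<in> W"
      using a unfolding split by (simp add: lincomb_def)
    then have "a i = 0" if "i < p" for i
      using f that unfolding indep_mod_def by blast
    then show ?thesis
      using 0[of "i - p"] i by (cases "i < p") auto
  qed
  moreover have "?h ` {..<p + q} \<subseteq> U"
    using f g unfolding indep_mod_def by auto
  ultimately show ?thesis
    unfolding indep_mod_def by blast
qed

text \<open>Appending \<open>u\<close> must destroy independence, and \<open>u\<close> must occur in
  the resulting relation since \<open>f\<close> alone is independent. As \<open>d\<close> need not
  be invertible, only a multiple of \<open>u\<close> is expressed through \<open>f\<close>.\<close>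

lemma rank_mod_maximal:
  fixes U :: "('a \<Rightarrow> 'r::ring_1_no_zero_divisors) set"
  assumes ore: "left_ore TYPE('r)"
    and X: "supported X U" and W: "(\<lambda>x. 0) \<in> W"
    and f: "indep_mod U W (rank_mod U W) f" and u: "u \<in> U"
  shows "\<exists>c d. d \<noteq> 0 \<and> (\<lambda>x. lincomb (rank_mod U W) c f x + d * u x) \<in> W"
proof -
  let ?n = "rank_mod U W"
  let ?g = "f(?n := u)"
  have ex: "lincomb (Suc ?n) a ?g = (\<lambda>x. lincomb ?n a f x + a ?n * u x)" for a
    by (simp add: lincomb_def)
  have "\<not> indep_mod U W (Suc ?n) ?g"
    using rank_mod_ge[OF ore X W, of "Suc ?n" ?g] by auto
  moreover have "?g ` {..<Suc ?n} \<subseteq> U"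
    using f u unfolding indep_mod_def by auto
  ultimately obtain a i where a: "lincomb (Suc ?n) a ?g \<in> W" "i < Suc ?n" "a i \<noteq> 0"
    unfolding indep_mod_def by blast
  have "a ?n \<noteq> 0"
  proof
    assume 0: "a ?n = 0"
    then have "lincomb ?n a f \<in> W"
      using a(1) unfolding ex by simp
    then show False
      using f a 0 unfolding indep_mod_def by (metis less_antisym)
  qed
  then show ?thesis
    using a(1) unfolding ex by blast
qed

lemma supported_subset: "supported X U \<Longrightarrow> W \<subseteq> U \<Longrightarrow> supported X W"
  by (auto simp: supported_def)

text \<open>For the lower bound, join a maximal family of \<open>W\<close> with one of
  \<open>U\<close> modulo \<open>W\<close>. For the upper bound, nonzero multiples of the
  \<open>f i\<close> are expressed through these two families; were there more of the
  \<open>f i\<close>, \<open>ore_dependent\<close> applied to the coefficient rows would give a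
  relation among them.\<close>

lemma rank_mod_add:
  fixes U :: "('a \<Rightarrow> 'r::ring_1_no_zero_divisors) set"
  assumes ore: "left_ore TYPE('r)"
    and X: "supported X U" and W: "submod W" "W \<subseteq> U"
  shows "rank_mod U {\<lambda>x. 0} = rank_mod U W + rank_mod W {\<lambda>x. 0}"
proof (rule antisym)
  let ?p = "rank_mod W {\<lambda>x. 0}" and ?q = "rank_mod U W" and ?n = "rank_mod U {\<lambda>x. 0}"
  note XW = supported_subset[OF X W(2)]
  have W0: "(\<lambda>x. 0) \<in> W"
    using W(1) by (simp add: submod_def)
  have z0: "(\<lambda>x. 0) \<in> {\<lambda>x. 0 :: 'r}"
    by simp
  obtain g where g: "indep_mod W {\<lambda>x. 0} ?p g"
    by (rule rank_mod_witness[OF ore XW z0])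
  obtain z where z: "indep_mod U W ?q z"
    by (rule rank_mod_witness[OF ore X W0])
  obtain f where f: "indep_mod U {\<lambda>x. 0} ?n f"
    by (rule rank_mod_witness[OF ore X z0])
  have "indep_mod U {\<lambda>x. 0} (?p + ?q) (\<lambda>i. if i < ?p then g i else z (i - ?p))"
    using g z W W0 by (intro indep_mod_append[where W' = W]) (auto simp: indep_mod_def)
  then show "?q + ?p \<le> ?n"
    using rank_mod_ge[OF ore X z0] by (simp add: add.commute)
  show "?n \<le> ?q + ?p"
  proof (rule ccontr)
    assume n: "\<not> ?n \<le> ?q + ?p"
    \<comment> \<open>Maximality is used twice: modulo \<open>W\<close> it moves a multiple of
      \<open>f i\<close> into \<open>W\<close> up to members of \<open>z\<close>, and inside
      \<open>W\<close> it expresses a further multiple through \<open>g\<close>. The product of the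
      two multipliers is nonzero.\<close>
    have "\<exists>A B d. d \<noteq> 0 \<and> (\<forall>x. lincomb ?p A g x + lincomb ?q B z x + d * f i x = 0)"
      if "i < ?n" for i
    proof -
      have "f i \<in> U"
        using f that unfolding indep_mod_def by auto
      from rank_mod_maximal[OF ore X W0 z this] obtain c d where
        cd: "d \<noteq> 0" "(\<lambda>x. lincomb ?q c z x + d * f i x) \<in> W"
        by blast
      from rank_mod_maximal[OF ore XW z0 g cd(2)] obtain c' d' where
        cd': "d' \<noteq> 0" "(\<lambda>x. lincomb ?p c' g x + d' * (lincomb ?q c z x + d * f i x)) \<in> {\<lambda>x. 0}"
        by blast
      have "lincomb ?p c' g x + lincomb ?q (\<lambda>j. d' * c j) z x + d' * d * f i x = 0" for x
        using fun_cong[of _ _ x, OF cd'(2)[unfolded singleton_iff]]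
        by (simp add: lincomb_def sum_distrib_left algebra_simps)
      then show ?thesis
        using cd(1) cd'(1) by (metis mult_eq_0_iff)
    qed
    then obtain A B d where d: "d i \<noteq> 0" and
      eq: "lincomb ?p (A i) g x + lincomb ?q (B i) z x + d i * f i x = 0" if "i < ?n" for i x
      by metis
    \<comment> \<open>One column for each member of \<open>g\<close> and of \<open>z\<close>. The
      resulting \<open>e\<close> annihilates every column, while \<open>e i * d i\<close> is nonzero
      for some \<open>i\<close>.\<close>
    have "card ({..<?p} <+> {..<?q}) < card {..<?n}"
      using n by (simp add: card_Plus)
    from ore_dependent[OF ore _ _ this, of "\<lambda>i. case_sum (A i) (B i)"]
    obtain e where e: "\<exists>i\<in>{..<?n}. e i \<noteq> 0"
      and e0: "\<forall>j\<in>{..<?p} <+> {..<?q}. (\<Sum>i<?n. e i * case_sum (A i) (B i) j) = 0"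
      by auto
    have eA: "(\<Sum>i<?n. e i * A i j) = 0" if "j < ?p" for j
      using e0 that by (force dest: bspec[where x = "Inl j"])
    have eB: "(\<Sum>i<?n. e i * B i j) = 0" if "j < ?q" for j
      using e0 that by (force dest: bspec[where x = "Inr j"])
    have swap: "(\<Sum>i<?n. e i * lincomb m (C i) y x) = (\<Sum>j<m. (\<Sum>i<?n. e i * C i j) * y j x)"
      for m C and y :: "nat \<Rightarrow> 'a \<Rightarrow> 'r" and x
      unfolding lincomb_def sum_distrib_left sum_distrib_right
      by (subst sum.swap) (simp add: mult.assoc)
    have "lincomb ?n (\<lambda>i. e i * d i) f x = 0" for x
    proof -
      have "0 = (\<Sum>i<?n. e i * (lincomb ?p (A i) g x + lincomb ?q (B i) z x + d i * f i x))"
        using eq by simp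
      also have "\<dots> = (\<Sum>i<?n. e i * lincomb ?p (A i) g x) + (\<Sum>i<?n. e i * lincomb ?q (B i) z x) +
          lincomb ?n (\<lambda>i. e i * d i) f x"
        by (simp add: lincomb_def[of ?n] distrib_left sum.distrib mult.assoc)
      also have "\<dots> = lincomb ?n (\<lambda>i. e i * d i) f x"
        unfolding swap by (simp add: eA eB)
      finally show ?thesis
        by simp
    qed
    then have "lincomb ?n (\<lambda>i. e i * d i) f = (\<lambda>x. 0)"
      by auto
    moreover have "\<forall>a. lincomb ?n a f \<in> {\<lambda>x. 0} \<longrightarrow> (\<forall>i<?n. a i = 0)"
      using f unfolding indep_mod_def by (rule conjunct2)
    ultimately have ed: "\<forall>i<?n. e i * d i = 0"
      by (metis (no_types, lifting) singletonI)
    obtain i where "i < ?n" "e i \<noteq> 0"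
      using e by blast
    then show False
      using d[of i] ed by auto
  qed
qed

text \<open>The isomorphism of an image with the quotient by the kernel, on the level of families: a
  family in the image is lifted by choosing preimages, and a combination of the lifts lies in the
  kernel exactly when the combination of their images vanishes.\<close>

lemma rank_mod_image:
  assumes T: "\<And>a f n. f ` {..<n} \<subseteq> U \<Longrightarrow> T (lincomb n a f) = lincomb n a (T \<circ> f)"
    and U: "submod U"
  shows "rank_mod (T ` U) {\<lambda>x. 0} = rank_mod U {u \<in> U. T u = (\<lambda>x. 0)}"
proof -
  have *: "indep_mod (T ` U) {\<lambda>x. 0} n (T \<circ> f) \<longleftrightarrow> indep_mod U {u \<in> U. T u = (\<lambda>x. 0)} n f"
    if "f ` {..<n} \<subseteq> U" for n f
    using that T[OF that] submod_lincomb[OF U that] by (auto simp: indep_mod_def)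
  have "(\<exists>f. indep_mod (T ` U) {\<lambda>x. 0} n f) \<longleftrightarrow> (\<exists>f. indep_mod U {u \<in> U. T u = (\<lambda>x. 0)} n f)" for n
  proof
    assume "\<exists>f. indep_mod (T ` U) {\<lambda>x. 0} n f"
    then obtain f where f: "indep_mod (T ` U) {\<lambda>x. 0} n f"
      by blast
    then have "\<forall>i<n. \<exists>u\<in>U. f i = T u"
      unfolding indep_mod_def by blast
    then obtain u where u: "\<forall>i<n. u i \<in> U \<and> f i = T (u i)"
      by metis
    then have "lincomb n a f = lincomb n a (T \<circ> u)" for a
      by (simp add: lincomb_def)
    then have "indep_mod (T ` U) {\<lambda>x. 0} n (T \<circ> u)"
      using f u unfolding indep_mod_def by auto
    then show "\<exists>f. indep_mod U {u \<in> U. T u = (\<lambda>x. 0)} n f"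
      using *[of u n] u by auto
  next
    assume "\<exists>f. indep_mod U {u \<in> U. T u = (\<lambda>x. 0)} n f"
    then obtain f where f: "indep_mod U {u \<in> U. T u = (\<lambda>x. 0)} n f"
      by blast
    then have "f ` {..<n} \<subseteq> U"
      unfolding indep_mod_def by (rule conjunct1)
    from *[OF this] f show "\<exists>f. indep_mod (T ` U) {\<lambda>x. 0} n f"
      by blast
  qed
  then show ?thesis
    by (simp add: rank_mod_def)
qed

section \<open>Cosets and the rank of a quotient module\<close>

lemma subquotient_simps:
  "carrier (subquotient C Z B) = (\<lambda>z. B +>\<^bsub>C\<^esub> z) ` Z"
  "\<zero>\<^bsub>subquotient C Z B\<^esub> = B"
  "K \<oplus>\<^bsub>subquotient C Z B\<^esub> K' = K <+>\<^bsub>C\<^esub> K'"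
  "a \<odot>\<^bsub>subquotient C Z B\<^esub> K = (\<Union>z\<in>K. B +>\<^bsub>C\<^esub> (a \<odot>\<^bsub>C\<^esub> z))"
  by (simp_all add: subquotient_def)

lemma chain_module_simps:
  "carrier (chain_module L k) = {c. \<forall>x. c x \<noteq> 0 \<longrightarrow> x \<in> cells L \<and> grade L x = k}"
  "B +>\<^bsub>chain_module L k\<^esub> z = {\<lambda>x. b x + z x |b. b \<in> B}"
  "K <+>\<^bsub>chain_module L k\<^esub> K' = {\<lambda>x. c x + d x |c d. c \<in> K \<and> d \<in> K'}"
  "a \<odot>\<^bsub>chain_module L k\<^esub> c = (\<lambda>x. a * c x)"
  by (auto simp: chain_module_def a_r_coset_def r_coset_def set_add_def set_mult_def)

context
  fixes L :: "('a, 'r::ring_1) lcomplex" and k :: nat and Z B :: "('a \<Rightarrow> 'r) set"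
  assumes B: "submod B" and Z: "submod Z"
begin

abbreviation (input) coset :: "('a \<Rightarrow> 'r) \<Rightarrow> ('a \<Rightarrow> 'r) set" where
  "coset z \<equiv> B +>\<^bsub>chain_module L k\<^esub> z"

abbreviation (input) quot :: "('r, ('a \<Rightarrow> 'r) set) module" where
  "quot \<equiv> subquotient (chain_module L k) Z B"

lemma mem_coset: "u \<in> coset z \<longleftrightarrow> (\<lambda>x. u x - z x) \<in> B"
proof
  assume "(\<lambda>x. u x - z x) \<in> B"
  then show "u \<in> coset z"
    unfolding chain_module_simps by (intro CollectI exI[of _ "\<lambda>x. u x - z x"]) simp
qed (auto simp: chain_module_simps)

lemma coset_cong:
  assumes "(\<lambda>x. u x - v x) \<in> B"
  shows "coset u = coset v"
proof -
  have "(\<lambda>x. w x - u x) \<in> B \<longleftrightarrow> (\<lambda>x. w x - v x) \<in> B" for w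
  proof
    assume "(\<lambda>x. w x - u x) \<in> B"
    then have "(\<lambda>x. (w x - u x) + (u x - v x)) \<in> B"
      using assms B unfolding submod_def by fast
    then show "(\<lambda>x. w x - v x) \<in> B"
      by simp
  next
    assume "(\<lambda>x. w x - v x) \<in> B"
    from submod_diff[OF B this assms] show "(\<lambda>x. w x - u x) \<in> B"
      by simp
  qed
  then show ?thesis
    by (auto simp: mem_coset)
qed

lemma coset_eq_zero: "coset z = B \<longleftrightarrow> z \<in> B"
proof
  have "z \<in> coset z"
    using B by (simp add: mem_coset submod_def)
  then show "coset z = B \<Longrightarrow> z \<in> B"
    by simp
  assume "z \<in> B"
  then have "coset z = coset (\<lambda>x. 0)"
    by (intro coset_cong) simp
  also have "\<dots> = B"
    by (auto simp: mem_coset)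
  finally show "coset z = B" .
qed

lemma coset_add: "coset u \<oplus>\<^bsub>quot\<^esub> coset v = coset (\<lambda>x. u x + v x)"
proof (intro equalityI subsetI)
  fix w assume "w \<in> coset u \<oplus>\<^bsub>quot\<^esub> coset v"
  then obtain c d where "w = (\<lambda>x. c x + d x)" "c \<in> coset u" "d \<in> coset v"
    unfolding subquotient_simps chain_module_simps(3) by blast
  then have w: "w = (\<lambda>x. c x + d x)" and "(\<lambda>x. c x - u x) \<in> B" "(\<lambda>x. d x - v x) \<in> B"
    by (simp_all add: mem_coset)
  then have "(\<lambda>x. (c x - u x) + (d x - v x)) \<in> B"
    using B unfolding submod_def by fast
  then show "w \<in> coset (\<lambda>x. u x + v x)"
    by (simp add: mem_coset w algebra_simps)
next
  fix w assume "w \<in> coset (\<lambda>x. u x + v x)"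
  then have "(\<lambda>x. (w x - v x) - u x) \<in> B"
    by (simp add: mem_coset algebra_simps)
  then have "(\<lambda>x. w x - v x) \<in> coset u"
    unfolding mem_coset .
  moreover have "v \<in> coset v"
    using B by (simp add: mem_coset submod_def)
  ultimately show "w \<in> coset u \<oplus>\<^bsub>quot\<^esub> coset v"
    unfolding subquotient_simps chain_module_simps(3)
    by (intro CollectI exI[of _ "\<lambda>x. w x - v x"] exI[of _ v]) simp
qed

lemma coset_smult: "a \<odot>\<^bsub>quot\<^esub> coset z = coset (\<lambda>x. a * z x)"
proof -
  have "coset (\<lambda>x. a * u x) = coset (\<lambda>x. a * z x)" if "u \<in> coset z" for u
  proof (rule coset_cong)
    have "(\<lambda>x. a * (u x - z x)) \<in> B"
      using B that unfolding mem_coset submod_def by fast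
    then show "(\<lambda>x. a * u x - a * z x) \<in> B"
      by (simp add: right_diff_distrib)
  qed
  moreover have "z \<in> coset z"
    using B by (simp add: mem_coset submod_def)
  ultimately show ?thesis
    unfolding subquotient_simps chain_module_simps(4) by blast
qed

text \<open>Scalars may be noncommutative, so the module locale is out of reach; a commutative
  monoid is enough to compute with \<open>finsum\<close>.\<close>

lemma abelian_monoid_quot: "abelian_monoid quot"
proof (rule abelian_monoidI)
  have zero: "\<zero>\<^bsub>quot\<^esub> = coset (\<lambda>x. 0)"
    using coset_eq_zero[of "\<lambda>x. 0"] B by (simp add: subquotient_simps submod_def)
  show "\<zero>\<^bsub>quot\<^esub> \<in> carrier quot"
    unfolding zero using Z by (auto simp: subquotient_simps submod_def)
  fix u v w assume "u \<in> carrier quot" "v \<in> carrier quot"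
  then obtain u' v' where uv: "u = coset u'" "v = coset v'" "u' \<in> Z" "v' \<in> Z"
    by (auto simp: subquotient_simps)
  show "u \<oplus>\<^bsub>quot\<^esub> v = v \<oplus>\<^bsub>quot\<^esub> u"
    by (simp only: uv coset_add add.commute)
  show "\<zero>\<^bsub>quot\<^esub> \<oplus>\<^bsub>quot\<^esub> u = u"
    by (simp only: uv zero coset_add add_0)
  have "(\<lambda>x. u' x + v' x) \<in> Z"
    using uv Z by (simp add: submod_def)
  then show "u \<oplus>\<^bsub>quot\<^esub> v \<in> carrier quot"
    unfolding uv coset_add by (simp add: subquotient_simps)
  assume "w \<in> carrier quot"
  then obtain w' where w: "w = coset w'"
    by (auto simp: subquotient_simps)
  show "u \<oplus>\<^bsub>quot\<^esub> v \<oplus>\<^bsub>quot\<^esub> w = u \<oplus>\<^bsub>quot\<^esub> (v \<oplus>\<^bsub>quot\<^esub> w)"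
    by (simp only: uv w coset_add add.assoc)
qed

lemma finsum_quot:
  assumes "f ` {..<n} \<subseteq> Z"
  shows "finsum quot (\<lambda>i. a i \<odot>\<^bsub>quot\<^esub> coset (f i)) {..<n} = coset (lincomb n a f)"
  using assms
proof (induction n)
  case 0
  then show ?case
    using abelian_monoid.finsum_empty[OF abelian_monoid_quot] coset_eq_zero[of "\<lambda>x. 0"] B
    by (simp add: lincomb_def subquotient_simps submod_def)
next
  case (Suc n)
  have car: "a i \<odot>\<^bsub>quot\<^esub> coset (f i) \<in> carrier quot" if "i < Suc n" for i
  proof -
    have "(\<lambda>x. a i * f i x) \<in> Z"
      using Suc.prems that Z unfolding submod_def by blast
    then show ?thesis
      unfolding coset_smult by (simp add: subquotient_simps)
  qed
  have "finsum quot (\<lambda>i. a i \<odot>\<^bsub>quot\<^esub> coset (f i)) {..<Suc n} =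
      (a n \<odot>\<^bsub>quot\<^esub> coset (f n)) \<oplus>\<^bsub>quot\<^esub> finsum quot (\<lambda>i. a i \<odot>\<^bsub>quot\<^esub> coset (f i)) {..<n}"
    unfolding lessThan_Suc
    by (rule abelian_monoid.finsum_insert[OF abelian_monoid_quot]) (use car in auto)
  also have "\<dots> = coset (\<lambda>x. a n * f n x) \<oplus>\<^bsub>quot\<^esub> coset (lincomb n a f)"
    using Suc by (simp add: coset_smult image_subset_iff)
  also have "\<dots> = coset (lincomb (Suc n) a f)"
    by (simp only: coset_add lincomb_def sum.lessThan_Suc add.commute)
  finally show ?case .
qed

text \<open>The bridge from the records in the definition of homology to \<open>rank_mod\<close>:
  families of cosets are replaced by families of representatives, and a sum of cosets is zero
  exactly when the sum of representatives lies in \<open>B\<close>.\<close>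

lemma module_rank_quot: "module_rank quot = rank_mod Z B"
proof -
  have *: "lin_indep_family quot n (\<lambda>i. coset (f i)) \<longleftrightarrow> indep_mod Z B n f"
    if "f ` {..<n} \<subseteq> Z" for n f
    using that finsum_quot[OF that]
    by (auto simp: lin_indep_family_def indep_mod_def coset_eq_zero subquotient_simps(1,2))
  have "(\<exists>g. lin_indep_family quot n g) \<longleftrightarrow> (\<exists>f. indep_mod Z B n f)" for n
  proof
    assume "\<exists>g. lin_indep_family quot n g"
    then obtain g where g: "lin_indep_family quot n g"
      by blast
    then have "\<forall>i<n. \<exists>z\<in>Z. g i = coset z"
      unfolding lin_indep_family_def subquotient_simps by blast
    then obtain f where f: "\<forall>i<n. f i \<in> Z \<and> g i = coset (f i)"
      by metis
    have "finsum quot (\<lambda>i. a i \<odot>\<^bsub>quot\<^esub> g i) {..<n} =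
        finsum quot (\<lambda>i. a i \<odot>\<^bsub>quot\<^esub> coset (f i)) {..<n}" for a
    proof (rule abelian_monoid.finsum_cong'[OF abelian_monoid_quot])
      have "(\<lambda>x. a i * f i x) \<in> Z" if "i < n" for i
        using f that Z unfolding submod_def by blast
      then show "(\<lambda>i. a i \<odot>\<^bsub>quot\<^esub> coset (f i)) \<in> {..<n} \<rightarrow> carrier quot"
        unfolding coset_smult by (auto simp: subquotient_simps)
    qed (use f in auto)
    then have "lin_indep_family quot n (\<lambda>i. coset (f i))"
      using g f unfolding lin_indep_family_def by auto
    then show "\<exists>f. indep_mod Z B n f"
      using *[of f n] f by auto
  next
    assume "\<exists>f. indep_mod Z B n f"
    then obtain f where f: "indep_mod Z B n f"
      by blast
    then have "f ` {..<n} \<subseteq> Z"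
      unfolding indep_mod_def by (rule conjunct1)
    from *[OF this] f show "\<exists>g. lin_indep_family quot n g"
      by blast
  qed
  then show ?thesis
    by (simp add: rank_mod_def module_rank_def)
qed

end

section \<open>Betti numbers and block triangular boundary maps\<close>

abbreviation chains :: "('a, 'r::ring_1) lcomplex \<Rightarrow> nat \<Rightarrow> ('a \<Rightarrow> 'r) set" where
  "chains L k \<equiv> carrier (chain_module L k)"

definition boundary_rank :: "('a, 'r::ring_1) lcomplex \<Rightarrow> nat \<Rightarrow> nat" where
  "boundary_rank L k = rank_mod (boundary L ` chains L k) {\<lambda>x. 0}"

lemma submod_chains: "submod (chains L k)"
proof -
  have "chains L k = {c. \<forall>x. \<not> (x \<in> cells L \<and> grade L x = k) \<longrightarrow> c x = 0}"
    unfolding chain_module_simps by blast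
  then show ?thesis
    by (simp add: submod_def)
qed

lemma supported_chains: "finite (cells L) \<Longrightarrow> supported {x \<in> cells L. grade L x = k} (chains L k)"
  by (auto simp: supported_def chain_module_simps)

lemma boundary_lincomb: "boundary L (lincomb n a f) = lincomb n a (boundary L \<circ> f)"
proof
  fix y
  have "(\<Sum>x\<in>cells L. (\<Sum>i<n. a i * f i x) * \<kappa>\<^bsub>L\<^esub> x y) = (\<Sum>i<n. a i * (\<Sum>x\<in>cells L. f i x * \<kappa>\<^bsub>L\<^esub> x y))"
    unfolding sum_distrib_left sum_distrib_right by (subst sum.swap) (simp add: mult.assoc)
  then show "boundary L (lincomb n a f) y = lincomb n a (boundary L \<circ> f) y"
    by (simp add: boundary_def lincomb_def)
qed

lemma boundary_zero: "boundary L (\<lambda>x. 0) = (\<lambda>y. 0)"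
  by (auto simp: boundary_def)

lemma boundary_add: "boundary L (\<lambda>x. u x + v x) = (\<lambda>y. boundary L u y + boundary L v y)"
  by (auto simp: boundary_def distrib_right sum.distrib)

lemma boundary_smult: "boundary L (\<lambda>x. a * u x) = (\<lambda>y. a * boundary L u y)"
  by (auto simp: boundary_def sum_distrib_left mult.assoc)

lemma submod_boundaries: "submod (boundary L ` chains L k)"
  unfolding submod_def
proof (intro conjI ballI allI)
  note C = submod_chains[of L k, unfolded submod_def]
  show "(\<lambda>x. 0) \<in> boundary L ` chains L k"
    using C by (intro image_eqI[of _ _ "\<lambda>x. 0"]) (simp_all add: boundary_zero)
  show "(\<lambda>x. u x + v x) \<in> boundary L ` chains L k"
    if uv: "u \<in> boundary L ` chains L k" "v \<in> boundary L ` chains L k" for u v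
  proof -
    obtain c d where "c \<in> chains L k" "u = boundary L c" "d \<in> chains L k" "v = boundary L d"
      using uv by blast
    then show ?thesis
      using C by (intro image_eqI[of _ _ "\<lambda>x. c x + d x"]) (simp_all add: boundary_add)
  qed
  show "(\<lambda>x. a * u x) \<in> boundary L ` chains L k" if u: "u \<in> boundary L ` chains L k" for a u
  proof -
    obtain c where "c \<in> chains L k" "u = boundary L c"
      using u by blast
    then show ?thesis
      using C by (intro image_eqI[of _ _ "\<lambda>x. a * c x"]) (simp_all add: boundary_smult)
  qed
qed

lemma submod_cycles: "submod {c \<in> chains L k. boundary L c = (\<lambda>y. 0)}"
  using submod_chains[of L k] unfolding submod_def
  by (simp add: boundary_zero boundary_add boundary_smult)

text \<open>Lets the regular multivectors enter the sum over all blocks without changing the Morse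
  numbers.\<close>

lemma rank_trivial_homology:
  assumes "carrier (homology K k) = {\<zero>\<^bsub>homology K k\<^esub>}"
  shows "module_rank (homology K k :: ('r::ring_1, ('a \<Rightarrow> 'r) set) module) = 0"
proof -
  let ?Z = "{c \<in> chains K k. boundary K c = (\<lambda>y. 0)}" and ?B = "boundary K ` chains K (Suc k)"
  have eq: "homology K k = subquotient (chain_module K k) ?Z ?B"
    by (simp add: homology_def)
  have "?Z \<subseteq> ?B"
  proof
    fix z assume z: "z \<in> ?Z"
    then have "?B +>\<^bsub>chain_module K k\<^esub> z \<in> carrier (homology K k)"
      unfolding eq subquotient_simps by blast
    then have "?B +>\<^bsub>chain_module K k\<^esub> z = ?B"
      unfolding assms unfolding eq subquotient_simps by blast
    then show "z \<in> ?B"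
      by (rule iffD1[OF coset_eq_zero[OF submod_boundaries submod_cycles]])
  qed
  have "n = 0" if f: "indep_mod ?Z ?B n f" for n and f :: "nat \<Rightarrow> 'a \<Rightarrow> 'r"
  proof (rule ccontr)
    assume "n \<noteq> 0"
    \<comment> \<open>Every cycle is a boundary, so already the plain sum of the family is a
      relation modulo boundaries, with all coefficients 1.\<close>
    have "lincomb n (\<lambda>_. 1) f \<in> ?Z"
      using f submod_cycles by (intro submod_lincomb) (auto simp: indep_mod_def)
    then have "lincomb n (\<lambda>_. 1) f \<in> ?B"
      using \<open>?Z \<subseteq> ?B\<close> by blast
    then have "\<forall>i<n. (1::'r) = 0"
      using f unfolding indep_mod_def by blast
    then show False
      using \<open>n \<noteq> 0\<close> by auto
  qed
  then have "(\<exists>f. indep_mod ?Z ?B n f) \<longleftrightarrow> n = 0" for n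
    by (auto simp: indep_mod_def)
  then have "rank_mod ?Z ?B = 0"
    unfolding rank_mod_def by (simp add: Greatest_equality)
  then show ?thesis
    unfolding eq by (simp add: module_rank_quot[OF submod_boundaries submod_cycles])
qed

text \<open>With \<open>Suc\<close> on the left, degree 0 is covered too: there the conclusion is
  impossible, so 0-chains have zero boundary.\<close>

lemma boundary_grade:
  assumes L: "lefschetz_complex L" and c: "c \<in> chains L k" and y: "boundary L c y \<noteq> 0"
  shows "y \<in> cells L" "Suc (grade L y) = k"
proof -
  have "y \<in> cells L" and "(\<Sum>x\<in>cells L. c x * \<kappa>\<^bsub>L\<^esub> x y) \<noteq> 0"
    using y by (auto simp: boundary_def split: if_splits)
  then show "y \<in> cells L"
    by simp
  obtain x where "x \<in> cells L" "c x * \<kappa>\<^bsub>L\<^esub> x y \<noteq> 0"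
    using \<open>(\<Sum>x\<in>cells L. c x * \<kappa>\<^bsub>L\<^esub> x y) \<noteq> 0\<close> by (meson sum.neutral)
  then have "c x \<noteq> 0" "\<kappa>\<^bsub>L\<^esub> x y \<noteq> 0"
    by auto
  then show "Suc (grade L y) = k"
    using c L \<open>x \<in> cells L\<close> \<open>y \<in> cells L\<close> unfolding chain_module_simps lefschetz_complex_def
    by auto
qed

lemma boundary_boundary:
  assumes L: "lefschetz_complex L"
  shows "boundary L (boundary L c) = (\<lambda>y. 0)"
proof
  fix z
  have "(\<Sum>y\<in>cells L. (\<Sum>x\<in>cells L. c x * \<kappa>\<^bsub>L\<^esub> x y) * \<kappa>\<^bsub>L\<^esub> y z) =
      (\<Sum>x\<in>cells L. c x * (\<Sum>y\<in>cells L. \<kappa>\<^bsub>L\<^esub> x y * \<kappa>\<^bsub>L\<^esub> y z))"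
    unfolding sum_distrib_left sum_distrib_right by (subst sum.swap) (simp add: mult.assoc)
  also have "\<dots> = 0" if "z \<in> cells L"
    using L that by (simp add: lefschetz_complex_def)
  finally show "boundary L (boundary L c) z = 0"
    by (auto simp: boundary_def cong: sum.cong)
qed

lemma boundaries_subset_cycles:
  assumes L: "lefschetz_complex L"
  shows "boundary L ` chains L (Suc k) \<subseteq> {c \<in> chains L k. boundary L c = (\<lambda>y. 0)}"
proof (intro image_subsetI CollectI conjI)
  fix c assume c: "c \<in> chains L (Suc k)"
  show "boundary L (boundary L c) = (\<lambda>y. 0)"
    by (rule boundary_boundary[OF L])
  have "y \<in> cells L \<and> grade L y = k" if "boundary L c y \<noteq> 0" for y
    using boundary_grade[OF L c that] by simp
  then show "boundary L c \<in> chains L k"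
    by (simp add: chain_module_simps)
qed

lemma rank_chains:
  fixes L :: "('a, 'r::ring_1_no_zero_divisors) lcomplex"
  assumes ore: "left_ore TYPE('r)"
    and fin: "finite (cells L)"
  shows "rank_mod (chains L k) {\<lambda>x. 0} = card {x \<in> cells L. grade L x = k}" (is "_ = card ?X")
proof (rule antisym)
  note X = supported_chains[OF fin, of k]
  show "rank_mod (chains L k) {\<lambda>x. 0} \<le> card ?X"
    by (rule rank_mod_le[OF ore X]) simp_all
  have "finite ?X"
    using fin by simp
  then obtain h where h: "bij_betw h {..<card ?X} ?X"
    using bij_betw_from_nat_into_finite lessThan_atLeast0 ex_bij_betw_nat_finite by metis
  let ?f = "\<lambda>i x. if x = h i then 1 else 0 :: 'r"
  have "indep_mod (chains L k) {\<lambda>x. 0} (card ?X) ?f"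
    unfolding indep_mod_def
  proof (intro conjI allI impI)
    show "?f ` {..<card ?X} \<subseteq> chains L k"
      using bij_betw_apply[OF h] by (auto simp: chain_module_simps split: if_splits)
    fix a i assume a: "lincomb (card ?X) a ?f \<in> {\<lambda>x. 0}" and i: "i < card ?X"
    have "(\<Sum>j<card ?X. a j * ?f j (h i)) = (\<Sum>j<card ?X. if j = i then a j else 0)"
      using inj_on_eq_iff[OF bij_betw_imp_inj_on[OF h], of i] i by (intro sum.cong) auto
    also have "\<dots> = a i"
      using i by simp
    finally show "a i = 0"
      using fun_cong[of _ _ "h i", OF a[unfolded singleton_iff]] by (simp add: lincomb_def)
  qed
  from rank_mod_ge[OF ore X _ this] show "card ?X \<le> rank_mod (chains L k) {\<lambda>x. 0}"
    by simp
qed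

text \<open>Additivity is applied to boundaries inside cycles inside chains, where chains modulo
  cycles have the rank of the image of the boundary map.\<close>

lemma betti_cells:
  fixes L :: "('a, 'r::ring_1_no_zero_divisors) lcomplex"
  assumes ore: "left_ore TYPE('r)"
    and L: "lefschetz_complex L"
  shows "int (module_rank (homology L k)) =
    int (card {x \<in> cells L. grade L x = k}) - int (boundary_rank L k) - int (boundary_rank L (Suc k))"
proof -
  have fin: "finite (cells L)"
    using L by (simp add: lefschetz_complex_def)
  note X = supported_chains[OF fin, of k]
  let ?Z = "{c \<in> chains L k. boundary L c = (\<lambda>y. 0)}" and ?B = "boundary L ` chains L (Suc k)"
  note BZ = boundaries_subset_cycles[OF L, of k]
  have ZC: "?Z \<subseteq> chains L k"
    by blast
  have "module_rank (homology L k) = rank_mod ?Z ?B"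
    unfolding homology_def by (rule module_rank_quot[OF submod_boundaries submod_cycles])
  moreover have "rank_mod (chains L k) {\<lambda>x. 0} = rank_mod (chains L k) ?Z + rank_mod ?Z {\<lambda>x. 0}"
    by (rule rank_mod_add[OF ore X submod_cycles ZC])
  moreover have "rank_mod ?Z {\<lambda>x. 0} = rank_mod ?Z ?B + rank_mod ?B {\<lambda>x. 0}"
    by (rule rank_mod_add[OF ore supported_subset[OF X ZC] submod_boundaries BZ])
  moreover have "rank_mod (boundary L ` chains L k) {\<lambda>x. 0} = rank_mod (chains L k) ?Z"
    by (rule rank_mod_image) (auto simp: boundary_lincomb submod_chains)
  ultimately show ?thesis
    using rank_chains[OF ore fin, of k] by (simp add: boundary_rank_def)
qed

lemma boundary_rank_0:
  fixes L :: "('a, 'r::ring_1_no_zero_divisors) lcomplex"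
  assumes ore: "left_ore TYPE('r)"
    and L: "lefschetz_complex L"
  shows "boundary_rank L 0 = 0"
proof -
  \<comment> \<open>The boundary of a 0-chain is zero, so the empty set of coordinates suffices and
    bounds the rank by 0.\<close>
  have "supported {} (boundary L ` chains L 0)"
    using boundary_grade[OF L, of _ 0] by (auto simp: supported_def)
  from rank_mod_le[OF ore this, of "{\<lambda>x. 0}"] show ?thesis
    by (simp add: boundary_rank_def)
qed

text \<open>A statement about matrices, so that it applies to partial unions of blocks. Boundaries
  of chains in \<open>A\<close> do not change when taken in the union and vanish on
  \<open>B\<close>; boundaries of chains in \<open>B\<close> may gain entries in \<open>A\<close>
  but keep those in \<open>B\<close>. Hence the first family lies in the functions vanishing on
  \<open>B\<close>, the second is independent modulo them, and \<open>indep_mod_append\<close> adds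
  the two.\<close>

lemma boundary_rank_triangular:
  fixes L :: "('a, 'r::ring_1_no_zero_divisors) lcomplex"
  assumes ore: "left_ore TYPE('r)"
    and fin: "finite (A \<union> B)" and disj: "A \<inter> B = {}"
    and tri: "\<And>x y. x \<in> A \<Longrightarrow> y \<in> B \<Longrightarrow> \<kappa>\<^bsub>L\<^esub> x y = 0"
  shows "boundary_rank (L \<restriction> A) k + boundary_rank (L \<restriction> B) k \<le> boundary_rank (L \<restriction> (A \<union> B)) k"
proof -
  let ?X = "A \<union> B"
  let ?C = "\<lambda>D. chains (L \<restriction> D) k"
  let ?im = "\<lambda>D. boundary (L \<restriction> D) ` ?C D"
  let ?W = "{u. \<forall>x\<in>B. u x = (0::'r)}"
  have supp: "supported D (?im D)" if "finite D" for D
    using that by (auto simp: supported_def boundary_def subcomplex_def)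
  have sub: "?C A \<subseteq> ?C ?X" "?C B \<subseteq> ?C ?X"
    by (auto simp: chain_module_simps subcomplex_def)
  have restr: "boundary (L \<restriction> ?X) c y = (\<Sum>x\<in>D. c x * \<kappa>\<^bsub>L\<^esub> x y)"
    if "D \<subseteq> ?X" "c \<in> ?C D" "y \<in> ?X" for D c y
  proof -
    have "(\<Sum>x\<in>?X. c x * \<kappa>\<^bsub>L\<^esub> x y) = (\<Sum>x\<in>D. c x * \<kappa>\<^bsub>L\<^esub> x y)"
      using fin that by (intro sum.mono_neutral_right) (auto simp: chain_module_simps subcomplex_def)
    then show ?thesis
      using that by (simp add: boundary_def subcomplex_def)
  qed
  have bA: "boundary (L \<restriction> ?X) c = boundary (L \<restriction> A) c" if "c \<in> ?C A" for c
  proof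
    fix y show "boundary (L \<restriction> ?X) c y = boundary (L \<restriction> A) c y"
    proof (cases "y \<in> ?X")
      case True
      then show ?thesis
        using restr[OF _ that True] tri disj by (auto simp: boundary_def subcomplex_def intro!: sum.neutral)
    qed (auto simp: boundary_def subcomplex_def)
  qed
  have bB: "boundary (L \<restriction> ?X) c y = boundary (L \<restriction> B) c y" if "c \<in> ?C B" "y \<in> B" for c y
    using restr[OF _ that(1)] that by (simp add: boundary_def subcomplex_def)
  have z: "(\<lambda>x. 0) \<in> {\<lambda>x. 0 :: 'r}"
    by simp
  have finAB: "finite A" "finite B"
    using fin by auto
  obtain f where f: "indep_mod (?im A) {\<lambda>x. 0} (boundary_rank (L \<restriction> A) k) f"
    unfolding boundary_rank_def by (rule rank_mod_witness[OF ore supp[OF finAB(1)] z])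
  obtain g where g: "indep_mod (?im B) {\<lambda>x. 0} (boundary_rank (L \<restriction> B) k) g"
    unfolding boundary_rank_def by (rule rank_mod_witness[OF ore supp[OF finAB(2)] z])
  let ?p = "boundary_rank (L \<restriction> A) k" and ?q = "boundary_rank (L \<restriction> B) k"
  have f': "indep_mod (?im ?X) {\<lambda>x. 0} ?p f" "f ` {..<?p} \<subseteq> ?W"
  proof -
    have "?im A \<subseteq> ?im ?X"
    proof (rule image_subsetI)
      fix c assume c: "c \<in> ?C A"
      then show "boundary (L \<restriction> A) c \<in> ?im ?X"
        using bA[OF c, symmetric] sub(1) by (intro image_eqI[of _ _ c]) auto
    qed
    then show "indep_mod (?im ?X) {\<lambda>x. 0} ?p f"
      using f unfolding indep_mod_def by blast
    have "?im A \<subseteq> ?W"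
      using disj by (auto simp: boundary_def subcomplex_def)
    then show "f ` {..<?p} \<subseteq> ?W"
      using f unfolding indep_mod_def by blast
  qed
  have "\<forall>i<?q. \<exists>d\<in>?C B. g i = boundary (L \<restriction> B) d"
    using g unfolding indep_mod_def by blast
  then obtain d where d: "\<forall>i<?q. d i \<in> ?C B \<and> g i = boundary (L \<restriction> B) (d i)"
    by metis
  \<comment> \<open>The chains behind \<open>g\<close>, with their boundary now taken in the whole
    union.\<close>
  let ?g = "\<lambda>i. boundary (L \<restriction> ?X) (d i)"
  have "indep_mod (?im ?X) ?W ?q ?g"
    unfolding indep_mod_def
  proof (intro conjI allI impI)
    show "?g ` {..<?q} \<subseteq> ?im ?X"
      using d sub(2) by blast
    fix a i assume a: "lincomb ?q a ?g \<in> ?W" and i: "i < ?q"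
    have "lincomb ?q a g y = 0" for y
    proof (cases "y \<in> B")
      case True
      then have "lincomb ?q a g y = lincomb ?q a ?g y"
        using d bB by (simp add: lincomb_def)
      then show ?thesis
        using a True by simp
    next
      case False
      then show ?thesis
        using d by (simp add: lincomb_def boundary_def subcomplex_def)
    qed
    then have "lincomb ?q a g = (\<lambda>x. 0)"
      by auto
    then show "a i = 0"
      using g i unfolding indep_mod_def by blast
  qed
  moreover have "submod ?W"
    by (simp add: submod_def)
  ultimately have "indep_mod (?im ?X) {\<lambda>x. 0} (?p + ?q) (\<lambda>i. if i < ?p then f i else ?g (i - ?p))"
    using f' by (intro indep_mod_append) auto
  from rank_mod_ge[OF ore supp[OF fin] z this] show ?thesis
    by (simp add: boundary_rank_def)
qed

text \<open>Blocks are added by increasing \<open>h\<close>. A nonzero coefficient from an earlier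
  block into the new one would force the new \<open>h\<close> to be smaller, so each step is
  triangular.\<close>

lemma boundary_rank_blocks:
  fixes L :: "('a, 'r::ring_1_no_zero_divisors) lcomplex" and h :: "'i \<Rightarrow> nat"
  assumes ore: "left_ore TYPE('r)"
    and "finite I" "\<And>i. i \<in> I \<Longrightarrow> finite (B i)" "disjoint_family_on B I"
    and "\<And>i j x y. \<lbrakk>i \<in> I; j \<in> I; i \<noteq> j; x \<in> B i; y \<in> B j; \<kappa>\<^bsub>L\<^esub> x y \<noteq> 0\<rbrakk> \<Longrightarrow> h j < h i"
  shows "(\<Sum>i\<in>I. boundary_rank (L \<restriction> B i) k) \<le> boundary_rank (L \<restriction> (\<Union>i\<in>I. B i)) k"
  using assms(2-)
proof (induction I rule: finite_ranking_induct[where f = h])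
  case empty
  then show ?case
    by simp
next
  case (insert i I)
  show ?case
  \<comment> \<open>The induction rule allows the new index to be a member of \<open>I\<close>
    already.\<close>
  proof (cases "i \<in> I")
    case True
    then show ?thesis
      using insert by (simp add: insert_absorb)
  next
    case False
    have IH: "(\<Sum>i\<in>I. boundary_rank (L \<restriction> B i) k) \<le> boundary_rank (L \<restriction> (\<Union>i\<in>I. B i)) k"
      using insert.prems by (intro insert.IH) (auto simp: disjoint_family_on_def)
    let ?A = "\<Union>j\<in>I. B j"
    have "?A \<inter> B i = {}"
      using insert.prems(2) False unfolding disjoint_family_on_def by fastforce
    moreover have "\<kappa>\<^bsub>L\<^esub> x y = 0" if xy: "x \<in> ?A" "y \<in> B i" for x y
    proof (rule ccontr)
      assume nz: "\<kappa>\<^bsub>L\<^esub> x y \<noteq> 0"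
      obtain j where "j \<in> I" "x \<in> B j"
        using xy by blast
      then have "h i < h j"
        using insert.prems(3)[of j i x y] nz xy False by auto
      then show False
        using insert.hyps(2)[OF \<open>j \<in> I\<close>] by simp
    qed
    moreover have "finite (?A \<union> B i)"
      using insert.hyps(1) insert.prems(1) by auto
    ultimately have "boundary_rank (L \<restriction> ?A) k + boundary_rank (L \<restriction> B i) k \<le>
        boundary_rank (L \<restriction> (?A \<union> B i)) k"
      by (intro boundary_rank_triangular[OF ore]) auto
    moreover have "?A \<union> B i = (\<Union>j\<in>insert i I. B j)"
      by blast
    ultimately show ?thesis
      using IH insert.hyps(1) False by simp
  qed
qed

lemma morse_inequalities_blocks:
  fixes L :: "('a, 'r::ring_1_no_zero_divisors) lcomplex" and h :: "'i \<Rightarrow> nat"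
  assumes ore: "left_ore TYPE('r)"
    and L: "lefschetz_complex L"
    and I: "finite I" and disj: "disjoint_family_on B I" and un: "(\<Union>i\<in>I. B i) = cells L"
    and h: "\<And>i j x y. \<lbrakk>i \<in> I; j \<in> I; i \<noteq> j; x \<in> B i; y \<in> B j; \<kappa>\<^bsub>L\<^esub> x y \<noteq> 0\<rbrakk> \<Longrightarrow> h j < h i"
  shows "(\<Sum>j\<le>k. (-1) ^ (k - j) * betti L (cells L) j) \<le>
      (\<Sum>j\<le>k. (-1) ^ (k - j) * (\<Sum>i\<in>I. betti L (B i) j))"
    and "betti L (cells L) k \<le> (\<Sum>i\<in>I. betti L (B i) k)"
proof -
  have fin: "finite (cells L)"
    using L by (simp add: lefschetz_complex_def)
  have sub: "B i \<subseteq> cells L" if "i \<in> I" for i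
    using un that by blast
  \<comment> \<open>This replaces properness of the blocks: a product of coefficients that leaves
    the block and comes back would make \<open>h\<close> drop twice and still return to its initial
    value. So the terms outside the block vanish in the sum for the squared boundary.\<close>
  have lef: "lefschetz_complex (L \<restriction> B i)" if i: "i \<in> I" for i
  proof -
    have "\<kappa>\<^bsub>L\<^esub> x y * \<kappa>\<^bsub>L\<^esub> y z = 0" if xyz: "x \<in> B i" "z \<in> B i" "y \<in> cells L - B i" for x y z
    proof (rule ccontr)
      assume "\<kappa>\<^bsub>L\<^esub> x y * \<kappa>\<^bsub>L\<^esub> y z \<noteq> 0"
      then have nz: "\<kappa>\<^bsub>L\<^esub> x y \<noteq> 0" "\<kappa>\<^bsub>L\<^esub> y z \<noteq> 0" by auto
      obtain j where "j \<in> I" "y \<in> B j" "j \<noteq> i"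
        using un xyz(3) by fastforce
      then have "h j < h i" "h i < h j"
        using h[of i j x y] h[of j i y z] i nz xyz by auto
      then show False
        by simp
    qed
    then have "(\<Sum>y\<in>B i. \<kappa>\<^bsub>L\<^esub> x y * \<kappa>\<^bsub>L\<^esub> y z) = (\<Sum>y\<in>cells L. \<kappa>\<^bsub>L\<^esub> x y * \<kappa>\<^bsub>L\<^esub> y z)"
      if "x \<in> B i" "z \<in> B i" for x z
      using fin sub[OF i] that by (intro sum.mono_neutral_left) auto
    then have "(\<Sum>y\<in>B i. \<kappa>\<^bsub>L\<^esub> x y * \<kappa>\<^bsub>L\<^esub> y z) = 0" if "x \<in> B i" "z \<in> B i" for x z
      using L sub[OF i] that unfolding lefschetz_complex_def by (simp add: subset_iff)
    then show ?thesis
      using L sub[OF i] finite_subset[OF sub[OF i] fin]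
      unfolding lefschetz_complex_def subcomplex_def by (simp add: subset_iff)
  qed
  \<comment> \<open>The part of the boundary rank that the diagonal blocks do not account
    for.\<close>
  define D where "D k = int (boundary_rank L k) - (\<Sum>i\<in>I. int (boundary_rank (L \<restriction> B i) k))" for k
  have Lc: "L \<restriction> cells L = L"
    by (simp add: subcomplex_def)
  have D: "D k \<ge> 0" for k
  proof -
    have "(\<Sum>i\<in>I. boundary_rank (L \<restriction> B i) k) \<le> boundary_rank L k"
      using boundary_rank_blocks[where L = L and h = h, OF ore I _ disj] finite_subset[OF sub fin] h
      unfolding un Lc by blast
    then show ?thesis
      unfolding D_def by (simp flip: of_nat_sum)
  qed
  have D0: "D 0 = 0"
    unfolding D_def using boundary_rank_0[OF ore L] boundary_rank_0[OF ore lef] by simp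
  \<comment> \<open>The blocks partition the cells, so the cell counts cancel and only the ranks in
    degrees \<open>k\<close> and \<open>Suc k\<close> remain.\<close>
  have diff: "(\<Sum>i\<in>I. betti L (B i) k) - betti L (cells L) k = D k + D (Suc k)" for k
  proof -
    have "{x \<in> cells L. grade L x = k} = (\<Union>i\<in>I. {x \<in> B i. grade L x = k})"
      using un by auto
    moreover have "card \<dots> = (\<Sum>i\<in>I. card {x \<in> B i. grade L x = k})"
      using I finite_subset[OF sub fin] disj
      by (intro card_UN_disjoint) (auto simp: disjoint_family_on_def)
    moreover have "betti L (B i) k = int (card {x \<in> B i. grade L x = k}) -
        int (boundary_rank (L \<restriction> B i) k) - int (boundary_rank (L \<restriction> B i) (Suc k))" if "i \<in> I" for i
      unfolding betti_def using betti_cells[OF ore lef[OF that]] by (simp add: subcomplex_def)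
    moreover have "betti L (cells L) k = int (card {x \<in> cells L. grade L x = k}) -
        int (boundary_rank L k) - int (boundary_rank L (Suc k))"
      unfolding betti_def Lc by (rule betti_cells[OF ore L])
    ultimately show ?thesis
      by (simp add: D_def sum_subtractf)
  qed
  show "betti L (cells L) k \<le> (\<Sum>i\<in>I. betti L (B i) k)"
    using diff[of k] D[of k] D[of "Suc k"] by linarith
  have "(\<Sum>j\<le>k. (-1) ^ (k - j) * ((\<Sum>i\<in>I. betti L (B i) j) - betti L (cells L) j)) = D (Suc k)"
  proof (induction k)
    case 0
    then show ?case
      by (simp add: diff D0)
  next
    case (Suc k)
    \<comment> \<open>Raising the upper limit by one flips the sign of all earlier terms, which sum
      to \<open>D (Suc k)\<close> by induction; this cancels against the first half of the new
      term.\<close>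
    have "(\<Sum>j\<le>k. (-1) ^ (Suc k - j) * (D j + D (Suc j))) = - (\<Sum>j\<le>k. (-1) ^ (k - j) * (D j + D (Suc j)))"
      unfolding sum_negf[symmetric] by (intro sum.cong) (auto simp: Suc_diff_le)
    then show ?case
      using Suc by (simp add: diff)
  qed
  then show "(\<Sum>j\<le>k. (-1) ^ (k - j) * betti L (cells L) j) \<le>
      (\<Sum>j\<le>k. (-1) ^ (k - j) * (\<Sum>i\<in>I. betti L (B i) j))"
    using D[of "Suc k"] by (simp add: right_diff_distrib sum_subtractf)
qed

section \<open>Multivector fields and their solutions\<close>

definition faces :: "('a, 'r::zero) lcomplex \<Rightarrow> 'a rel" where
  "faces L = {(y, x). x \<in> cells L \<and> y \<in> cells L \<and> \<kappa>\<^bsub>L\<^esub> x y \<noteq> 0}"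

lemma faces_rtrancl_grade:
  assumes L: "lefschetz_complex L" and yx: "(y, x) \<in> (faces L)\<^sup>*"
  shows "y = x \<or> grade L y < grade L x"
  using yx
proof (induction rule: rtrancl_induct)
  case (step w x)
  then show ?case
    using L unfolding faces_def lefschetz_complex_def by fastforce
qed simp

text \<open>Turns the intersection of orders into chains of faces, on which one can do induction.
  The closure is antisymmetric because grades strictly increase along a face relation; the
  restriction removes the reflexive pairs outside of the complex.\<close>

lemma face_order_eq:
  assumes L: "lefschetz_complex L"
  shows "face_order L = (faces L)\<^sup>* \<inter> cells L \<times> cells L"
proof
  note po = partial_order_on_face_order[OF L]
  let ?R = "(faces L)\<^sup>* \<inter> cells L \<times> cells L"
  have "partial_order_on (cells L) ?R"
    unfolding partial_order_on_def preorder_on_def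
  proof (intro conjI)
    show "?R \<subseteq> cells L \<times> cells L"
      by blast
    show "refl_on (cells L) ?R"
      by (auto simp: refl_on_def)
    show "trans ?R"
      by (auto simp: trans_def intro: rtrancl_trans)
    show "antisym ?R"
    proof (rule antisymI)
      fix x y assume "(x, y) \<in> ?R" "(y, x) \<in> ?R"
      then have "(x, y) \<in> (faces L)\<^sup>*" "(y, x) \<in> (faces L)\<^sup>*"
        by blast+
      from this[THEN faces_rtrancl_grade[OF L]] show "x = y"
        by auto
    qed
  qed
  then show "face_order L \<subseteq> ?R"
    unfolding face_order_def by (intro Inter_lower) (auto simp: faces_def)
  have "(y, x) \<in> face_order L" if "(y, x) \<in> (faces L)\<^sup>*" "y \<in> cells L" for y x
    using that
  proof (induction rule: rtrancl_induct)
    case base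
    then show ?case
      using partial_order_onD(1)[OF po] by (simp add: refl_on_def)
  next
    case (step w x)
    then have "(w, x) \<in> face_order L"
      by (intro face_orderI) (auto simp: faces_def)
    then show ?case
      using step transD[OF partial_order_onD(2)[OF po]] by blast
  qed
  then show "?R \<subseteq> face_order L"
    by auto
qed

text \<open>A missing intermediate cell would lie in the mouth; being closed, the mouth would then
  contain the lower cell as well, although that belongs to \<open>A\<close>.\<close>

lemma proper_set_convex:
  assumes L: "lefschetz_complex L" and A: "proper_set L A"
    and "z \<in> A" "x \<in> A" "(z, w) \<in> face_order L" "(w, x) \<in> face_order L"
  shows "w \<in> A"
proof (rule ccontr)
  assume "w \<notin> A"
  have sub: "A \<subseteq> cells L" and mo: "closedin (face_topology L) (mo L A)"
    using A unfolding proper_set_def by auto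
  have "w \<in> cells L" "z \<in> cells L"
    using assms(5,6) partial_order_onD(4)[OF partial_order_on_face_order[OF L]] by auto
  have "w \<in> mo L A"
    using assms \<open>w \<notin> A\<close> \<open>w \<in> cells L\<close> unfolding mo_def cl_eq[OF L sub] by blast
  moreover have "cl L (mo L A) = mo L A"
    using mo unfolding cl_def by (simp add: closure_of_closedin)
  moreover have "mo L A \<subseteq> cells L"
    unfolding mo_def cl_eq[OF L sub] by blast
  ultimately have "z \<in> mo L A"
    using assms(5) \<open>z \<in> cells L\<close> cl_eq[OF L, of "mo L A"] by blast
  then show False
    using assms(3) unfolding mo_def by blast
qed

lemma mv_unique:
  assumes "partition_on X \<V>" "W \<in> \<V>" "x \<in> W"
  shows "mv \<V> x = W"
  unfolding mv_def
proof (rule the_equality)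
  fix U assume "U \<in> \<V> \<and> x \<in> U"
  then show "U = W"
    using assms partition_onD2[OF assms(1)] unfolding disjoint_def by blast
qed (use assms in blast)

text \<open>The face order of the restricted complex may be smaller, since a chain of faces can
  leave \<open>S\<close>. Within one multivector the two orders agree, because convexity keeps the
  whole chain inside; so maximal elements and properness carry over.\<close>

lemma multivector_field_restrict:
  assumes L: "lefschetz_complex L" and V: "multivector_field L \<V>"
    and S: "compatible L \<V> S" and LS: "lefschetz_complex (L \<restriction> S)"
  shows "multivector_field (L \<restriction> S) {W \<in> \<V>. W \<subseteq> S}"
proof -
  let ?K = "L \<restriction> S" and ?\<W> = "{W \<in> \<V>. W \<subseteq> S}"
  have part: "partition_on (cells L) \<V>" and mult: "\<And>W. W \<in> \<V> \<Longrightarrow> multivector L W"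
    using V unfolding multivector_field_def by auto
  have Sc: "S \<subseteq> cells L" and Smv: "\<And>x. x \<in> S \<Longrightarrow> mv \<V> x \<subseteq> S"
    using S unfolding compatible_def by auto
  have K: "cells ?K = S"
    by (simp add: subcomplex_def)
  have Kf: "faces ?K \<subseteq> faces L"
    using Sc by (auto simp: faces_def subcomplex_def)
  have le: "(y, x) \<in> face_order L" if "(y, x) \<in> face_order ?K" for y x
    using that rtrancl_mono[OF Kf] Sc unfolding face_order_eq[OF L] face_order_eq[OF LS] K by blast
  have "partition_on S ?\<W>"
  proof (rule partition_onI)
    show "\<Union>?\<W> = S"
    proof
      show "S \<subseteq> \<Union>?\<W>"
      proof
        fix x assume x: "x \<in> S"
        then obtain W where W: "W \<in> \<V>" "x \<in> W"
          using Sc partition_onD1[OF part] by blast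
        then have "W \<subseteq> S"
          using Smv[OF x] mv_unique[OF part W] by simp
        then show "x \<in> \<Union>?\<W>"
          using W by blast
      qed
    qed blast
    show "{} \<notin> ?\<W>"
      using partition_onD3[OF part] by blast
    show "disjnt U W" if "U \<in> ?\<W>" "W \<in> ?\<W>" "U \<noteq> W" for U W
      using that partition_onD2[OF part] unfolding disjoint_def disjnt_def by blast
  qed
  moreover have "multivector ?K W" if "W \<in> ?\<W>" for W
  proof -
    have W: "W \<subseteq> S" "multivector L W" "proper_set L W"
      using that mult by (auto simp: multivector_def)
    note conv = proper_set_convex[OF L W(3)]
    have up: "(y, x) \<in> (faces ?K)\<^sup>*" if "(y, x) \<in> (faces L)\<^sup>*" "y \<in> W" "x \<in> W" for x y
      using that
    proof (induction rule: converse_rtrancl_induct)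
      case (step y w)
      have "(y, w) \<in> face_order L" "(w, x) \<in> face_order L"
        using step W(1) Sc unfolding face_order_eq[OF L] by (auto simp: faces_def)
      then have "w \<in> W"
        using conv step by blast
      moreover have "(y, w) \<in> faces ?K"
        using step W(1) \<open>w \<in> W\<close> by (auto simp: faces_def subcomplex_def)
      ultimately show ?case
        using step by (meson converse_rtrancl_into_rtrancl)
    qed simp
    have eq: "(y, x) \<in> face_order ?K \<longleftrightarrow> (y, x) \<in> face_order L" if "y \<in> W" "x \<in> W" for x y
      using le up that W(1) unfolding face_order_eq[OF L] face_order_eq[OF LS] K by blast
    have "maximal_in ?K W = maximal_in L W"
      unfolding maximal_in_def using eq by blast
    moreover have "proper_set ?K W"
      unfolding proper_set_def K
    proof
      note poK = partial_order_on_face_order[OF LS]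
      have WK: "W \<subseteq> cells ?K"
        using W(1) K by simp
      show "closedin (face_topology ?K) (mo ?K W)"
        unfolding closedin_def topspace_face_topology[OF LS] openin_face_topology
      proof (intro conjI ballI allI impI)
        show "mo ?K W \<subseteq> cells ?K"
          unfolding mo_def cl_eq[OF LS WK] by blast
        fix y x assume y: "y \<in> cells ?K - mo ?K W" and yx: "(y, x) \<in> face_order ?K"
        then have x: "x \<in> cells ?K"
          using partial_order_onD(4)[OF poK] by auto
        show "x \<in> cells ?K - mo ?K W"
        proof (rule ccontr)
          assume "x \<notin> cells ?K - mo ?K W"
          then obtain w where w: "w \<in> W" "(x, w) \<in> face_order ?K" "x \<notin> W"
            using x unfolding mo_def cl_eq[OF LS WK] by blast
          have "(y, w) \<in> face_order ?K"
            using yx w(2) by (rule transD[OF partial_order_onD(2)[OF poK]])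
          \<comment> \<open>\<open>y\<close> is in the closure of \<open>W\<close> but not in its
            mouth. Convexity for \<open>y\<close>, \<open>x\<close>, \<open>w\<close> then puts
            \<open>x\<close> into \<open>W\<close>, a contradiction.\<close>
          then have "y \<in> W"
            using y w unfolding mo_def cl_eq[OF LS WK] by blast
          then show False
            using conv[OF _ w(1) le[OF yx] le[OF w(2)]] w(3) by blast
        qed
      qed blast
    qed (rule W(1))
    ultimately show ?thesis
      using W(2) unfolding multivector_def by simp
  qed
  ultimately show ?thesis
    unfolding multivector_field_def K by blast
qed

lemma compat_interior_compatible: "compatible L \<V> A \<Longrightarrow> compat_interior L \<V> A = A"
  unfolding compat_interior_def by blast

text \<open>The solution through the star of \<open>x\<close> runs in the compatible interior, so
  some compatible subset of \<open>A\<close> contains this star and with it the whole multivector of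
  \<open>x\<close>.\<close>

lemma invariant_compatible:
  assumes part: "partition_on (cells L) \<V>" and A: "invariant L \<V> A"
    and star: "\<And>x. x \<in> cells L \<Longrightarrow> star L \<V> x \<in> mv \<V> x"
  shows "compatible L \<V> A"
  unfolding compatible_def
proof (intro conjI ballI)
  show Ac: "A \<subseteq> cells L"
    using A by (simp add: invariant_def)
  fix x assume x: "x \<in> A"
  then have "x \<in> Inv L \<V> A"
    using A by (simp add: invariant_def)
  then have "star L \<V> x \<in> compat_interior L \<V> A"
    unfolding Inv_def Sol_def by blast
  then obtain B where B: "compatible L \<V> B" "B \<subseteq> A" "star L \<V> x \<in> B"
    unfolding compat_interior_def by blast
  obtain W where W: "W \<in> \<V>" "x \<in> W"
    using x Ac partition_onD1[OF part] by blast
  have "mv \<V> x = W"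
    by (rule mv_unique[OF part W])
  then have "mv \<V> (star L \<V> x) = mv \<V> x"
    using star[of x] x Ac mv_unique[OF part W(1)] by auto
  then show "mv \<V> x \<subseteq> A"
    using B unfolding compatible_def by blast
qed

section \<open>Solutions as walks along the multivector map\<close>

locale mvf =
  fixes L :: "('a, 'r::ring_1) lcomplex" and \<V> :: "'a set set"
  assumes lefschetz: "lefschetz_complex L" and field: "multivector_field L \<V>"
begin

lemma finite_cells: "finite (cells L)"
  using lefschetz by (simp add: lefschetz_complex_def)

lemma part: "partition_on (cells L) \<V>"
  using field by (simp add: multivector_field_def)

lemma mv_in:
  assumes "x \<in> cells L"
  shows "mv \<V> x \<in> \<V>" "x \<in> mv \<V> x" "mv \<V> x \<subseteq> cells L"
proof -
  obtain W where W: "W \<in> \<V>" "x \<in> W"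
    using assms partition_onD1[OF part] by blast
  have "mv \<V> x = W"
    by (rule mv_unique[OF part W])
  then show "mv \<V> x \<in> \<V>" "x \<in> mv \<V> x"
    using W by auto
  then show "mv \<V> x \<subseteq> cells L"
    using partition_onD1[OF part] by blast
qed

lemma mv_eq: "x \<in> cells L \<Longrightarrow> y \<in> mv \<V> x \<Longrightarrow> mv \<V> y = mv \<V> x"
  using mv_unique[OF part] mv_in by blast

lemma star_eq: "x \<in> cells L \<Longrightarrow> y \<in> mv \<V> x \<Longrightarrow> star L \<V> y = star L \<V> x"
  unfolding star_def using mv_eq by simp

text \<open>In a finite poset a unique maximal element is the greatest one: a cell of highest grade
  above \<open>x\<close> in the multivector is maximal, hence the star.\<close>

lemma star_max:
  assumes x: "x \<in> cells L"
  shows "star L \<V> x \<in> mv \<V> x" "(x, star L \<V> x) \<in> face_order L"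
proof -
  note po = partial_order_on_face_order[OF lefschetz]
  let ?W = "mv \<V> x"
  have uniq: "\<exists>!v. maximal_in L ?W v"
    using field mv_in(1)[OF x] by (simp add: multivector_field_def multivector_def)
  then have star: "maximal_in L ?W (star L \<V> x)"
    unfolding star_def by (rule theI')
  then show "star L \<V> x \<in> ?W"
    unfolding maximal_in_def by blast
  let ?A = "{w \<in> ?W. (x, w) \<in> face_order L}"
  have "x \<in> ?A"
    using mv_in(2)[OF x] x partial_order_onD(1)[OF po] by (simp add: refl_on_def)
  moreover have fin: "finite ?A"
    using finite_subset[OF mv_in(3)[OF x] finite_cells] by simp
  ultimately have "Max (grade L ` ?A) \<in> grade L ` ?A"
    by (intro Max_in) auto
  then obtain w where w: "w \<in> ?A" "grade L w = Max (grade L ` ?A)"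
    by auto
  have "u = w" if u: "u \<in> ?W" "(w, u) \<in> face_order L" for u
  proof -
    have "(x, u) \<in> face_order L"
      using w(1) u(2) transD[OF partial_order_onD(2)[OF po]] by blast
    then have "grade L u \<le> grade L w"
      unfolding w(2) using u(1) fin by (intro Max_ge) auto
    moreover have "w = u \<or> grade L w < grade L u"
      using u(2) faces_rtrancl_grade[OF lefschetz] unfolding face_order_eq[OF lefschetz] by blast
    ultimately show ?thesis
      by auto
  qed
  then have "maximal_in L ?W w"
    using w(1) unfolding maximal_in_def by blast
  then have "star L \<V> x = w"
    using uniq star by blast
  then show "(x, star L \<V> x) \<in> face_order L"
    using w(1) by blast
qed

lemma star_cells: "x \<in> cells L \<Longrightarrow> star L \<V> x \<in> cells L"
  using star_max(1) mv_in(3) by blast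

lemma star_star: "x \<in> cells L \<Longrightarrow> star L \<V> (star L \<V> x) = star L \<V> x"
  using star_eq star_max(1) by blast

lemma mv_star: "x \<in> cells L \<Longrightarrow> mv \<V> (star L \<V> x) = mv \<V> x"
  using mv_eq star_max(1) by blast

lemma star_mv: "x \<in> cells L \<Longrightarrow> y \<in> cells L \<Longrightarrow> star L \<V> x = star L \<V> y \<Longrightarrow> mv \<V> x = mv \<V> y"
  using mv_star by metis

lemma Pi_star: "x \<in> cells L \<Longrightarrow> x \<noteq> star L \<V> x \<Longrightarrow> \<Pi> L \<V> x = {star L \<V> x}"
  using star_cells unfolding mv_map_def by auto

lemma Pi_cells: "y \<in> \<Pi> L \<V> x \<Longrightarrow> y \<in> cells L"
  unfolding mv_map_def by simp

definition step :: "'a rel" where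
  "step = {(x, y). x \<in> cells L \<and> y \<in> \<Pi> L \<V> x}"

lemma step_star: "x \<in> cells L \<Longrightarrow> (x, star L \<V> x) \<in> step\<^sup>*"
  using Pi_star[of x] by (cases "x = star L \<V> x") (auto simp: step_def)

text \<open>This is where algebra becomes dynamics. A face \<open>y\<close> of \<open>x\<close> lies
  below the star of \<open>x\<close>; if it belongs to another multivector, it is a successor of
  that star, and from \<open>y\<close> one moves on to its own star.\<close>

lemma face_step:
  assumes xy: "x \<in> cells L" "y \<in> cells L" "\<kappa>\<^bsub>L\<^esub> x y \<noteq> 0"
  shows "(star L \<V> x, star L \<V> y) \<in> step\<^sup>*"
proof (cases "mv \<V> x = mv \<V> y")
  case True
  then show ?thesis
    by (simp add: star_def)
next
  case False
  note po = partial_order_on_face_order[OF lefschetz]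
  have s: "star L \<V> x \<in> cells L"
    using xy star_cells by blast
  have "(y, star L \<V> x) \<in> face_order L"
    using star_max(2)[OF xy(1)] face_orderI[OF xy] transD[OF partial_order_onD(2)[OF po]] by blast
  then have "y \<in> cl L {star L \<V> x}"
    using cl_eq[OF lefschetz, of "{star L \<V> x}"] s xy by auto
  moreover have "y \<notin> mv \<V> (star L \<V> x)"
    using False mv_star[OF xy(1)] mv_eq[OF xy(1)] by auto
  ultimately have "(star L \<V> x, y) \<in> step"
    using s xy star_star[OF xy(1)] by (auto simp: step_def mv_map_def)
  then show ?thesis
    using step_star[OF xy(2)] by (rule converse_rtrancl_into_rtrancl)
qed

lemma critical_step:
  assumes "x \<in> cells L" "\<not> regular L (mv \<V> x)"
  shows "(star L \<V> x, star L \<V> x) \<in> step"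
  using assms star_cells star_star mv_star unfolding step_def mv_map_def by auto

text \<open>Half of a full solution, with \<open>u\<close> running against time. Only the far end
  must lie in \<open>A\<close>, so that the property is passed along paths.\<close>

definition backward :: "'a set \<Rightarrow> 'a \<Rightarrow> bool" where
  "backward A x \<longleftrightarrow>
     (\<exists>u::nat \<Rightarrow> 'a. u 0 = x \<and> (\<forall>n. (u (Suc n), u n) \<in> step) \<and> (\<exists>N. \<forall>n\<ge>N. u n \<in> A))"

definition forward :: "'a set \<Rightarrow> 'a \<Rightarrow> bool" where
  "forward A x \<longleftrightarrow>
     (\<exists>u::nat \<Rightarrow> 'a. u 0 = x \<and> (\<forall>n. (u n, u (Suc n)) \<in> step) \<and> (\<exists>N. \<forall>n\<ge>N. u n \<in> A))"

lemma backward_rtrancl: "(x, y) \<in> step\<^sup>* \<Longrightarrow> backward A x \<Longrightarrow> backward A y"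
proof (induction rule: rtrancl_induct)
  case (step y z)
  then obtain u N where u: "u 0 = y" "\<forall>n. (u (Suc n), u n) \<in> local.step" "\<forall>n\<ge>N. u n \<in> A"
    unfolding backward_def by blast
  let ?v = "case_nat z u"
  have "\<forall>n. (?v (Suc n), ?v n) \<in> local.step"
    using u(1,2) step.hyps(2) by (auto split: nat.split)
  moreover have "\<forall>n\<ge>Suc N. ?v n \<in> A"
    using u(3) by (auto split: nat.split)
  ultimately show ?case
    unfolding backward_def by (intro exI[of _ ?v]) auto
qed

lemma forward_rtrancl: "(x, y) \<in> step\<^sup>* \<Longrightarrow> forward A y \<Longrightarrow> forward A x"
proof (induction rule: converse_rtrancl_induct)
  case (step z y)
  then obtain u N where u: "u 0 = y" "\<forall>n. (u n, u (Suc n)) \<in> local.step" "\<forall>n\<ge>N. u n \<in> A"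
    unfolding forward_def by blast
  let ?v = "case_nat z u"
  have "\<forall>n. (?v n, ?v (Suc n)) \<in> local.step"
    using u(1,2) step.hyps(1) by (auto split: nat.split)
  moreover have "\<forall>n\<ge>Suc N. ?v n \<in> A"
    using u(3) by (auto split: nat.split)
  ultimately show ?case
    unfolding forward_def by (intro exI[of _ ?v]) auto
qed

lemma full_solution_iff: "full_solution L \<V> \<phi> \<longleftrightarrow> (\<forall>i. (\<phi> i, \<phi> (i + 1)) \<in> step)"
  unfolding solution_def step_def using Pi_cells by auto

lemma glue:
  assumes "backward A x" "forward B x"
  obtains \<phi> M N where "full_solution L \<V> \<phi>" "x \<in> range \<phi>"
    "\<forall>i\<le>- int M. \<phi> i \<in> A" "\<forall>i\<ge>int N. \<phi> i \<in> B"
proof -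
  obtain u M where u: "u 0 = x" "\<forall>n. (u (Suc n), u n) \<in> step" "\<forall>n\<ge>M. u n \<in> A"
    using assms(1) unfolding backward_def by blast
  obtain v N where v: "v 0 = x" "\<forall>n. (v n, v (Suc n)) \<in> step" "\<forall>n\<ge>N. v n \<in> B"
    using assms(2) unfolding forward_def by blast
  let ?\<phi> = "\<lambda>i::int. if 0 \<le> i then v (nat i) else u (nat (- i))"
  have st: "(?\<phi> i, ?\<phi> (i + 1)) \<in> step" for i
  proof (cases "0 \<le> i")
    case True
    then show ?thesis
      using v(2) by (simp add: nat_add_distrib)
  next
    case False
    then have "?\<phi> (i + 1) = u (nat (- (i + 1)))"
      using u(1) v(1) by auto
    moreover have "nat (- i) = Suc (nat (- (i + 1)))"
      using False by linarith
    ultimately show ?thesis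
      using False u(2) by simp
  qed
  show ?thesis
  \<comment> \<open>\<open>Suc M\<close> keeps the index strictly negative, where the glued solution
    is given by \<open>u\<close>; at 0 it is given by \<open>v\<close>.\<close>
  proof (rule that[of ?\<phi> "Suc M" N])
    show "full_solution L \<V> ?\<phi>"
      unfolding full_solution_iff using st by blast
    show "x \<in> range ?\<phi>"
      using v(1) by (intro range_eqI[of _ _ 0]) simp
    show "\<forall>i\<le>- int (Suc M). ?\<phi> i \<in> A"
      using u(3) by auto
    show "\<forall>i\<ge>int N. ?\<phi> i \<in> B"
      using v(3) by (auto simp: le_nat_iff)
  qed
qed

section \<open>Periodic solutions, recurrence and limit sets\<close>

lemma cycle_solution:
  assumes "(x, x) \<in> (step \<inter> A \<times> A)\<^sup>+"
  obtains \<psi> n where "full_solution L \<V> \<psi>" "range \<psi> \<subseteq> A" "n > 0" "\<forall>m. \<psi> (m * int n) = x"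
proof -
  obtain n where n: "n > 0" "(x, x) \<in> (step \<inter> A \<times> A) ^^ n"
    using assms unfolding trancl_power by blast
  then obtain f where f: "f 0 = x" "f n = x" "\<forall>i<n. (f i, f (Suc i)) \<in> step \<inter> A \<times> A"
    unfolding relpow_fun_conv by blast
  let ?\<psi> = "\<lambda>i. f (nat (i mod int n))"
  have lt: "nat (i mod int n) < n" for i
    using n(1) by (simp add: nat_less_iff)
  have b: "0 \<le> i mod int n" "i mod int n < int n" for i
    using n(1) by simp_all
  have eq: "?\<psi> (i + 1) = f (Suc (nat (i mod int n)))" for i
  \<comment> \<open>At the end of a period the residue jumps to 0 instead of \<open>n\<close>;
    \<open>f\<close> has the same value at both.\<close>
  proof (cases "i mod int n + 1 = int n")
    case True
    then have "(i + 1) mod int n = 0"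
      by (metis mod_add_left_eq mod_self)
    moreover have "Suc (nat (i mod int n)) = n"
      using True b[of i] by linarith
    ultimately show ?thesis
      using f(1,2) by simp
  next
    case False
    have "(i + 1) mod int n = (i mod int n + 1) mod int n"
      by (simp add: mod_add_left_eq)
    also have "\<dots> = i mod int n + 1"
      using b[of i] False by (intro mod_pos_pos_trivial) auto
    finally have "(i + 1) mod int n = i mod int n + 1" .
    then show ?thesis
      using b[of i] by (simp add: nat_add_distrib)
  qed
  have st: "(?\<psi> i, ?\<psi> (i + 1)) \<in> step \<inter> A \<times> A" for i
    unfolding eq using f(3) lt by blast
  have "range ?\<psi> \<subseteq> A"
    using st by blast
  moreover have "full_solution L \<V> ?\<psi>"
    unfolding full_solution_iff using st by blast
  moreover have "\<forall>m. ?\<psi> (m * int n) = x"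
    using f(1) by simp
  ultimately show ?thesis
    using n(1) by (intro that)
qed

text \<open>The stretch between two visits to \<open>x\<close> repeats to a periodic full solution
  inside \<open>A\<close>.\<close>

lemma recurrent_Inv:
  assumes \<phi>: "full_solution L \<V> \<phi>" and ij: "i < j" "\<phi> i = x" "\<phi> j = x"
    and A: "\<phi> ` {i..j} \<subseteq> A" "compatible L \<V> A"
  shows "x \<in> Inv L \<V> A"
proof -
  have "(\<phi> i, \<phi> (i + 1 + int n)) \<in> (step \<inter> A \<times> A)\<^sup>+" if "i + 1 + int n \<le> j" for n
    using that
  proof (induction n)
    case 0
    then have "\<phi> i \<in> A" "\<phi> (i + 1) \<in> A"
      using A(1) by auto
    then show ?case
      using \<phi> unfolding full_solution_iff by auto
  next
    case (Suc n)
    let ?k = "i + 1 + int n"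
    have "\<phi> ?k \<in> A" "\<phi> (?k + 1) \<in> A"
      using A(1) Suc.prems by auto
    then have "(\<phi> ?k, \<phi> (?k + 1)) \<in> step \<inter> A \<times> A"
      using \<phi> unfolding full_solution_iff by blast
    moreover have "?k + 1 = i + 1 + int (Suc n)"
      by simp
    moreover have "(\<phi> i, \<phi> ?k) \<in> (step \<inter> A \<times> A)\<^sup>+"
      using Suc by simp
    ultimately show ?case
      by (metis (no_types, lifting) trancl.trancl_into_trancl)
  qed
  from this[of "nat (j - i - 1)"] have "(x, x) \<in> (step \<inter> A \<times> A)\<^sup>+"
    using ij by simp
  then obtain \<psi> n where \<psi>: "full_solution L \<V> \<psi>" "range \<psi> \<subseteq> A" "n > 0" "\<forall>m. \<psi> (m * int n) = x"
    by (rule cycle_solution)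
  have "\<psi> 0 = x"
    using spec[OF \<psi>(4), of 0] by simp
  then have x: "x \<in> A" "x \<in> cells L" "x \<in> range \<psi>"
    using \<psi>(1,2) unfolding solution_def by auto
  \<comment> \<open>\<open>Inv\<close> asks for a solution through the star. If \<open>x\<close> is
    not its own star, the periodic solution has no choice but to move there from
    \<open>x\<close>.\<close>
  have "star L \<V> x \<in> range \<psi>"
  proof (cases "x = star L \<V> x")
    case False
    have "\<psi> (0 + 1) \<in> \<Pi> L \<V> (\<psi> 0)"
      using \<psi>(1) unfolding solution_def by blast
    then have "\<psi> (0 + 1) = star L \<V> x"
      using Pi_star[OF x(2) False] \<open>\<psi> 0 = x\<close> by simp
    then show ?thesis
      by (metis rangeI)
  qed (use x in simp)
  then show ?thesis
    using x \<psi> compat_interior_compatible[OF A(2)] unfolding Inv_def Sol_def by auto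
qed

lemma compatible_hull:
  assumes "A \<subseteq> cells L"
  shows "compatible L \<V> (compat_hull L \<V> A)" "A \<subseteq> compat_hull L \<V> A"
proof -
  have "compatible L \<V> (cells L)"
    using mv_in by (auto simp: compatible_def)
  then show "compatible L \<V> (compat_hull L \<V> A)" "A \<subseteq> compat_hull L \<V> A"
    using assms unfolding compat_hull_def compatible_def by blast+
qed

lemma recurrent_alpha:
  assumes \<phi>: "full_solution L \<V> \<phi>" and x: "\<And>k. \<exists>i\<le>- int k. \<phi> i = x"
  shows "x \<in> alpha_limit L \<V> \<phi>"
  unfolding alpha_limit_def
proof (rule INT_I)
  fix k
  have sub: "\<phi> ` {..- int k} \<subseteq> cells L"
    using \<phi> unfolding solution_def by auto
  obtain j where j: "j \<le> - int k" "\<phi> j = x"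
    using x by blast
  \<comment> \<open>A second visit strictly before \<open>j\<close>: since \<open>j\<close> is not
    positive, the bound is \<open>j - 1\<close>.\<close>
  obtain i where i: "i \<le> - int (nat (- j) + 1)" "\<phi> i = x"
    using x by blast
  have "i < j" "\<phi> ` {i..j} \<subseteq> \<phi> ` {..- int k}"
    using i(1) j(1) by auto
  then show "x \<in> Inv L \<V> (compat_hull L \<V> (\<phi> ` {..- int k}))"
    using i(2) j(2) compatible_hull[OF sub] by (intro recurrent_Inv[OF \<phi>, of i j]) auto
qed

lemma recurrent_omega:
  assumes \<phi>: "full_solution L \<V> \<phi>" and x: "\<And>k. \<exists>i\<ge>int k. \<phi> i = x"
  shows "x \<in> omega_limit L \<V> \<phi>"
  unfolding omega_limit_def
proof (rule INT_I)
  fix k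
  have sub: "\<phi> ` {int k..} \<subseteq> cells L"
    using \<phi> unfolding solution_def by auto
  obtain i where i: "i \<ge> int k" "\<phi> i = x"
    using x by blast
  obtain j where j: "j \<ge> int (nat i + 1)" "\<phi> j = x"
    using x by blast
  have "i < j" "\<phi> ` {i..j} \<subseteq> \<phi> ` {int k..}"
    using i(1) j(1) by auto
  then show "x \<in> Inv L \<V> (compat_hull L \<V> (\<phi> ` {int k..}))"
    using i(2) j(2) compatible_hull[OF sub] by (intro recurrent_Inv[OF \<phi>, of i j]) auto
qed

lemma infinitely_often:
  fixes f :: "nat \<Rightarrow> 'a"
  assumes "range f \<subseteq> cells L"
  obtains x where "\<And>k. \<exists>n\<ge>k. f n = x"
proof -
  have "finite (f ` UNIV)"
    using assms finite_cells by (rule finite_subset)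
  then obtain m where "infinite {n \<in> UNIV. f n = f m}"
    using pigeonhole_infinite[of UNIV f] by auto
  then have "\<exists>n\<ge>k. f n = f m" for k
    unfolding infinite_nat_iff_unbounded_le by auto
  then show ?thesis
    by (rule that)
qed

text \<open>An inclusion of a limit set in a Morse set says nothing if the limit set is empty. A
  value taken infinitely often in the tail lies both in the limit set and in \<open>A\<close>, so
  disjointness identifies the Morse set in which the limit set lies.\<close>

lemma alpha_meets:
  assumes \<phi>: "full_solution L \<V> \<phi>" and M: "\<forall>i\<le>- int M. \<phi> i \<in> A"
  shows "alpha_limit L \<V> \<phi> \<inter> A \<noteq> {}"
proof -
  have "range (\<lambda>n. \<phi> (- int n)) \<subseteq> cells L"
    using \<phi> unfolding solution_def by auto
  then obtain x where x: "\<And>k. \<exists>n\<ge>k. \<phi> (- int n) = x"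
    by (rule infinitely_often) blast
  have "\<exists>i\<le>- int k. \<phi> i = x" for k
  proof -
    obtain n where "n \<ge> k" "\<phi> (- int n) = x"
      using x by blast
    then show ?thesis
      by (intro exI[of _ "- int n"]) simp
  qed
  then have "x \<in> alpha_limit L \<V> \<phi>" and "x \<in> A"
    using recurrent_alpha[OF \<phi>] M by blast+
  then show ?thesis
    by blast
qed

lemma omega_meets:
  assumes \<phi>: "full_solution L \<V> \<phi>" and N: "\<forall>i\<ge>int N. \<phi> i \<in> A"
  shows "omega_limit L \<V> \<phi> \<inter> A \<noteq> {}"
proof -
  have "range (\<lambda>n. \<phi> (int n)) \<subseteq> cells L"
    using \<phi> unfolding solution_def by auto
  then obtain x where x: "\<And>k. \<exists>n\<ge>k. \<phi> (int n) = x"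
    by (rule infinitely_often) blast
  have "\<exists>i\<ge>int k. \<phi> i = x" for k
  proof -
    obtain n where "n \<ge> k" "\<phi> (int n) = x"
      using x by blast
    then show ?thesis
      by (intro exI[of _ "int n"]) simp
  qed
  then have "x \<in> omega_limit L \<V> \<phi>" and "x \<in> A"
    using recurrent_omega[OF \<phi>] N by blast+
  then show ?thesis
    by blast
qed

end

lemma (in mvf) cycle_recurrent:
  assumes "(x, x) \<in> step\<^sup>+"
  obtains \<phi> where "full_solution L \<V> \<phi>" "x \<in> alpha_limit L \<V> \<phi>"
proof -
  have "(x, x) \<in> (step \<inter> UNIV \<times> UNIV)\<^sup>+"
    using assms by simp
  then obtain \<psi> n where \<psi>: "full_solution L \<V> \<psi>" "range \<psi> \<subseteq> UNIV" "n > 0"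
    "\<forall>m. \<psi> (m * int n) = x"
    by (rule cycle_solution)
  have "\<exists>i\<le>- int k. \<psi> i = x" for k
  proof (intro exI conjI)
    have "int k * 1 \<le> int k * int n"
      using \<psi>(3) by (intro mult_left_mono) auto
    then show "- int k * int n \<le> - int k"
      by simp
    show "\<psi> (- int k * int n) = x"
      using \<psi>(4) by blast
  qed
  from recurrent_alpha[OF \<psi>(1) this] \<psi>(1) show ?thesis
    by (intro that)
qed

section \<open>The blocks of a Morse decomposition\<close>

locale morse = mvf L \<V> for L :: "('a, 'r::ring_1) lcomplex" and \<V> +
  fixes P :: "'p set" and M :: "'p \<Rightarrow> 'a set" and R :: "'p rel"
  assumes finite_P: "finite P" and po: "partial_order_on P R"
    and disjoint: "disjoint_family_on M P"
    and iso: "\<And>r. r \<in> P \<Longrightarrow> isolated_invariant L \<V> (M r)"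
    and limits: "\<And>\<phi>. full_solution L \<V> \<phi> \<Longrightarrow> \<exists>r\<in>P. \<exists>r'\<in>P. (r, r') \<in> R \<and>
      alpha_limit L \<V> \<phi> \<subseteq> M r' \<and> omega_limit L \<V> \<phi> \<subseteq> M r"
    and homoclinic: "\<And>\<phi> r. \<lbrakk>r \<in> P; full_solution L \<V> \<phi>;
      alpha_limit L \<V> \<phi> \<union> omega_limit L \<V> \<phi> \<subseteq> M r\<rbrakk> \<Longrightarrow> range \<phi> \<subseteq> M r"
begin

lemma M_invariant: "r \<in> P \<Longrightarrow> invariant L \<V> (M r)"
  using iso by (simp add: isolated_invariant_def)

lemma M_cells: "r \<in> P \<Longrightarrow> M r \<subseteq> cells L"
  using M_invariant by (simp add: invariant_def)

lemma M_compatible: "r \<in> P \<Longrightarrow> compatible L \<V> (M r)"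
  using invariant_compatible[OF part M_invariant] star_max(1) by blast

lemma M_unique: "r \<in> P \<Longrightarrow> s \<in> P \<Longrightarrow> x \<in> M r \<Longrightarrow> x \<in> M s \<Longrightarrow> r = s"
  using disjoint unfolding disjoint_family_on_def by blast

lemma M_star_iff: "r \<in> P \<Longrightarrow> x \<in> cells L \<Longrightarrow> star L \<V> x \<in> M r \<longleftrightarrow> x \<in> M r"
  using M_compatible[of r] star_max(1) mv_star[of x] mv_in(2)[of x]
  unfolding compatible_def by blast

lemma M_rays:
  assumes r: "r \<in> P" and x: "x \<in> M r"
  shows "backward (M r) (star L \<V> x)" "forward (M r) (star L \<V> x)"
proof -
  have "x \<in> Inv L \<V> (M r)"
    using M_invariant[OF r] x by (simp add: invariant_def)
  then obtain \<phi> where "full_solution L \<V> \<phi>" "range \<phi> \<subseteq> M r" "star L \<V> x \<in> range \<phi>"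
    using compat_interior_compatible[OF M_compatible[OF r]] unfolding Inv_def Sol_def by auto
  then obtain j where \<phi>: "\<And>i. (\<phi> i, \<phi> (i + 1)) \<in> step" "\<And>i. \<phi> i \<in> M r" "\<phi> j = star L \<V> x"
    unfolding full_solution_iff by force
  have "(\<phi> (j - int (Suc n)), \<phi> (j - int n)) \<in> step" for n
    using \<phi>(1)[of "j - int (Suc n)"] by simp
  then show "backward (M r) (star L \<V> x)"
    unfolding backward_def using \<phi>(2,3) by (intro exI[of _ "\<lambda>n. \<phi> (j - int n)"]) simp
  have "(\<phi> (j + int n), \<phi> (j + int (Suc n))) \<in> step" for n
    using \<phi>(1)[of "j + int n"] by (simp add: ac_simps)
  then show "forward (M r) (star L \<V> x)"
    unfolding forward_def using \<phi>(2,3) by (intro exI[of _ "\<lambda>n. \<phi> (j + int n)"]) simp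
qed

text \<open>The two rays are glued to a full solution. Its limit sets meet \<open>M r\<close> and
  \<open>M s\<close>, so these are the Morse sets named in the Morse decomposition; for
  \<open>r = s\<close> the homoclinic condition swallows the whole solution, including
  \<open>x\<close>.\<close>

lemma connection:
  assumes "r \<in> P" "s \<in> P" "backward (M r) x" "forward (M s) x"
  shows "(s, r) \<in> R" "r = s \<Longrightarrow> x \<in> M r"
proof -
  obtain \<phi> m n where \<phi>: "full_solution L \<V> \<phi>" "x \<in> range \<phi>"
    and tails: "\<forall>i\<le>- int m. \<phi> i \<in> M r" "\<forall>i\<ge>int n. \<phi> i \<in> M s"
    using glue[OF assms(3,4)] by metis
  obtain q q' where q: "q \<in> P" "q' \<in> P" "(q, q') \<in> R"
    "alpha_limit L \<V> \<phi> \<subseteq> M q'" "omega_limit L \<V> \<phi> \<subseteq> M q"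
    using limits[OF \<phi>(1)] by blast
  have "M q' \<inter> M r \<noteq> {}" "M q \<inter> M s \<noteq> {}"
    using alpha_meets[OF \<phi>(1) tails(1)] omega_meets[OF \<phi>(1) tails(2)] q(4,5) by auto
  then have eq: "q' = r" "q = s"
    using M_unique q(1,2) assms(1,2) by blast+
  then show "(s, r) \<in> R"
    using q(3) by simp
  assume "r = s"
  then show "x \<in> M r"
    using homoclinic[OF assms(1) \<phi>(1)] q(4,5) eq \<phi>(2) by blast
qed

section \<open>Reachability with Morse sets collapsed\<close>

lemma cycle_in_M: "(x, x) \<in> step\<^sup>+ \<Longrightarrow> \<exists>r\<in>P. x \<in> M r"
  using cycle_recurrent limits by (metis subsetD)

text \<open>The transitive closure of \<^const>\<open>step\<close>, read on the maximal elements of multivectors, after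
  each Morse set has been collapsed to a point; in this closed form its transitivity is immediate.\<close>

definition reach :: "'a \<Rightarrow> 'a \<Rightarrow> bool" where
  "reach x y \<longleftrightarrow> (star L \<V> x, star L \<V> y) \<in> step\<^sup>* \<or>
     (\<exists>r\<in>P. \<exists>r'\<in>P. (r', r) \<in> R \<and> forward (M r) (star L \<V> x) \<and> backward (M r') (star L \<V> y))"

lemma R_trans: "(r, s) \<in> R \<Longrightarrow> (s, t) \<in> R \<Longrightarrow> (r, t) \<in> R"
  using transD[OF partial_order_onD(2)[OF po]] .

lemma R_antisym: "(r, s) \<in> R \<Longrightarrow> (s, r) \<in> R \<Longrightarrow> r = s"
  using antisymD[OF partial_order_onD(3)[OF po]] .

text \<open>Paths are absorbed by the rays. Two jumps meet at the star of \<open>y\<close>, which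
  has a ray coming from \<open>M r'\<close> and a ray going into \<open>M s\<close>; so
  \<open>s\<close> is below \<open>r'\<close>, and the inequalities compose.\<close>

lemma reach_trans:
  assumes xy: "reach x y" and yz: "reach y z"
  shows "reach x z"
  using xy[unfolded reach_def]
proof
  assume xy: "(star L \<V> x, star L \<V> y) \<in> step\<^sup>*"
  show ?thesis
    using yz forward_rtrancl[OF xy] rtrancl_trans[OF xy] unfolding reach_def by blast
next
  assume "\<exists>r\<in>P. \<exists>r'\<in>P. (r', r) \<in> R \<and> forward (M r) (star L \<V> x) \<and> backward (M r') (star L \<V> y)"
  then obtain r r' where r: "r \<in> P" "r' \<in> P" "(r', r) \<in> R"
    "forward (M r) (star L \<V> x)" "backward (M r') (star L \<V> y)"
    by blast
  show ?thesis
    using yz[unfolded reach_def]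
  proof
    assume "(star L \<V> y, star L \<V> z) \<in> step\<^sup>*"
    then show ?thesis
      using backward_rtrancl[OF _ r(5)] r unfolding reach_def by blast
  next
    assume "\<exists>r\<in>P. \<exists>r'\<in>P. (r', r) \<in> R \<and> forward (M r) (star L \<V> y) \<and> backward (M r') (star L \<V> z)"
    then obtain s s' where s: "s \<in> P" "s' \<in> P" "(s', s) \<in> R"
      "forward (M s) (star L \<V> y)" "backward (M s') (star L \<V> z)"
      by blast
    have "(s', r) \<in> R"
      using R_trans[OF s(3) R_trans[OF connection(1)[OF r(2) s(1) r(5) s(4)] r(3)]] .
    then show ?thesis
      using r s unfolding reach_def by blast
  qed
qed

lemma reach_refl: "reach x x"
  unfolding reach_def by simp

text \<open>The collapse itself: a jump from a Morse set to the same Morse set, allowed by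
  reflexivity of the order.\<close>

lemma reach_M:
  assumes "r \<in> P" "x \<in> M r" "y \<in> M r"
  shows "reach x y"
  using assms M_rays partial_order_onD(1)[OF po] unfolding reach_def refl_on_def by blast

text \<open>The cycle puts the star of \<open>x\<close> into a Morse set. The star of
  \<open>y\<close> then lies on a connection of this Morse set to itself.\<close>

lemma step_cycle_M:
  assumes "x \<in> cells L" "y \<in> cells L" "star L \<V> x \<noteq> star L \<V> y"
    and "(star L \<V> x, star L \<V> y) \<in> step\<^sup>*" "(star L \<V> y, star L \<V> x) \<in> step\<^sup>*"
  shows "\<exists>r\<in>P. x \<in> M r \<and> y \<in> M r"
proof -
  have "(star L \<V> x, star L \<V> x) \<in> step\<^sup>+"
    using assms(3-5) by (metis rtranclD trancl_rtrancl_trancl)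
  then obtain r where r: "r \<in> P" "x \<in> M r"
    using cycle_in_M M_star_iff assms(1) by blast
  have "star L \<V> y \<in> M r"
    using connection(2)[OF r(1) r(1)] backward_rtrancl[OF assms(4)] forward_rtrancl[OF assms(5)]
      M_rays[OF r] by blast
  then show ?thesis
    using r M_star_iff assms(2) by blast
qed

text \<open>The path continues the ray out of \<open>M r'\<close> into the ray towards
  \<open>M r\<close>. This connection gives \<open>r\<close> below \<open>r'\<close>, so the two are
  equal and both stars lie on connections of \<open>M r\<close> to itself.\<close>

lemma step_jump_M:
  assumes "x \<in> cells L" "y \<in> cells L"
    and xy: "(star L \<V> x, star L \<V> y) \<in> step\<^sup>*"
    and r: "r \<in> P" "r' \<in> P" "(r', r) \<in> R"
      "forward (M r) (star L \<V> y)" "backward (M r') (star L \<V> x)"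
  shows "\<exists>r\<in>P. x \<in> M r \<and> y \<in> M r"
proof -
  have f: "forward (M r) (star L \<V> x)" and b: "backward (M r') (star L \<V> y)"
    using forward_rtrancl[OF xy r(4)] backward_rtrancl[OF xy r(5)] by blast+
  have "r' = r"
    using connection(1)[OF r(2,1) r(5) f] r(3) R_antisym by blast
  then have "star L \<V> x \<in> M r" "star L \<V> y \<in> M r"
    using connection(2)[OF r(2,1) r(5) f] connection(2)[OF r(2,1) b r(4)] by auto
  then show ?thesis
    using r(1) assms(1,2) M_star_iff by blast
qed

lemma reach_antisym:
  assumes x: "x \<in> cells L" and y: "y \<in> cells L" and xy: "reach x y" and yx: "reach y x"
  shows "mv \<V> x = mv \<V> y \<or> (\<exists>r\<in>P. x \<in> M r \<and> y \<in> M r)"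
proof (cases "(star L \<V> x, star L \<V> y) \<in> step\<^sup>*")
  case True
  show ?thesis
  proof (cases "(star L \<V> y, star L \<V> x) \<in> step\<^sup>*")
    case yx': True
    show ?thesis
      using star_mv[OF x y] step_cycle_M[OF x y _ True yx'] by blast
  next
    case False
    then show ?thesis
      using yx step_jump_M[OF x y True] unfolding reach_def by blast
  qed
next
  case False
  then obtain r r' where r: "r \<in> P" "r' \<in> P" "(r', r) \<in> R"
    "forward (M r) (star L \<V> x)" "backward (M r') (star L \<V> y)"
    using xy unfolding reach_def by blast
  show ?thesis
  proof (cases "(star L \<V> y, star L \<V> x) \<in> step\<^sup>*")
    case True
    then show ?thesis
      using step_jump_M[OF y x True r] by blast
  next
    case False
    then obtain s s' where s: "s \<in> P" "s' \<in> P" "(s', s) \<in> R"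
      "forward (M s) (star L \<V> y)" "backward (M s') (star L \<V> x)"
      using yx unfolding reach_def by blast
    \<comment> \<open>With the two jumps this closes a loop of inequalities from \<open>s'\<close>
      over \<open>s\<close>, \<open>r'\<close> and \<open>r\<close> back to \<open>s'\<close>, so
      all four indices coincide.\<close>
    have c: "(r, s') \<in> R" "(s, r') \<in> R"
      using connection(1)[OF s(2) r(1) s(5) r(4)] connection(1)[OF r(2) s(1) r(5) s(4)] .
    have "r = s'" "s = r'"
      using R_antisym[OF c(1) R_trans[OF s(3) R_trans[OF c(2) r(3)]]]
        R_antisym[OF c(2) R_trans[OF r(3) R_trans[OF c(1) s(3)]]] .
    then have "star L \<V> x \<in> M r" "star L \<V> y \<in> M s" "r = s"
      using connection(2)[OF s(2) r(1) s(5) r(4)] connection(2)[OF r(2) s(1) r(5) s(4)]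
        R_antisym r(3) s(3) by auto
    then show ?thesis
      using r(1) x y M_star_iff by blast
  qed
qed

definition height :: "'a \<Rightarrow> nat" where
  "height x = card {y \<in> cells L. reach x y}"

lemma height_mono: "reach x y \<Longrightarrow> height y \<le> height x"
  unfolding height_def using finite_cells reach_trans by (intro card_mono) auto

text \<open>Reachable sets shrink along \<open>reach\<close>, so equal cardinality means equal sets,
  and \<open>x\<close> is in its own. Thus \<open>height\<close> strictly drops along every
  \<open>reach\<close> that cannot be reversed.\<close>

lemma height_eq_imp_reach:
  assumes "x \<in> cells L" "reach x y" "height x \<le> height y"
  shows "reach y x"
proof -
  have "{z \<in> cells L. reach y z} = {z \<in> cells L. reach x z}"
    using assms(2,3) finite_cells reach_trans unfolding height_def by (intro card_seteq) auto
  then show ?thesis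
    using assms(1) reach_refl by blast
qed

text \<open>Tagged indices keep apart Morse sets that are empty and therefore equal as sets.\<close>

fun block :: "'p + 'a set \<Rightarrow> 'a set" where
  "block (Inl r) = M r"
| "block (Inr V) = V"

definition rest :: "'a set set" where
  "rest = {V \<in> \<V>. \<forall>r\<in>P. V \<inter> M r = {}}"

lemma rest_cells: "V \<in> rest \<Longrightarrow> V \<subseteq> cells L"
  using partition_onD1[OF part] unfolding rest_def by blast

lemma finite_rest: "finite rest"
  using finite_elements[OF finite_cells part] unfolding rest_def by simp

lemma block_cells: "i \<in> P <+> rest \<Longrightarrow> block i \<subseteq> cells L"
  by (auto dest!: M_cells rest_cells)

lemma block_unique:
  assumes "i \<in> P <+> rest" "j \<in> P <+> rest" "x \<in> block i" "x \<in> block j"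
  shows "i = j"
proof -
  have VW: "V = W" if "V \<in> rest" "W \<in> rest" "x \<in> V" "x \<in> W" for V W
    using that mv_unique[OF part] unfolding rest_def by blast
  have rV: False if "r \<in> P" "V \<in> rest" "x \<in> M r" "x \<in> V" for r V
    using that unfolding rest_def by blast
  show ?thesis
    using assms(1)
  proof
    fix r assume "r \<in> P" "i = Inl r"
    then show ?thesis
      using assms(2-4) M_unique[of r] rV by (auto elim!: PlusE)
  next
    fix V assume V: "V \<in> rest" "i = Inr V"
    show ?thesis
      using assms(2)
    proof
      fix W assume "W \<in> rest" "j = Inr W"
      then show ?thesis
        using VW[of V W] V assms(3,4) by simp
    qed (use rV V assms(3,4) in auto)
  qed
qed

lemma block_disjoint: "disjoint_family_on block (P <+> rest)"
  unfolding disjoint_family_on_def using block_unique by blast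

lemma block_union: "(\<Union>i\<in>P <+> rest. block i) = cells L"
proof
  show "(\<Union>i\<in>P <+> rest. block i) \<subseteq> cells L"
    using block_cells by blast
  show "cells L \<subseteq> (\<Union>i\<in>P <+> rest. block i)"
  proof
    fix x assume x: "x \<in> cells L"
    show "x \<in> (\<Union>i\<in>P <+> rest. block i)"
    proof (cases "\<exists>r\<in>P. x \<in> M r")
      case True
      then obtain r where "r \<in> P" "x \<in> M r"
        by blast
      then show ?thesis
        by (intro UN_I[of "Inl r"]) auto
    next
      case False
      \<comment> \<open>Morse sets are unions of multivectors, so a multivector that meets one is
        contained in it.\<close>
      have "mv \<V> x \<inter> M r = {}" if r: "r \<in> P" for r
      proof (rule ccontr)
        assume "mv \<V> x \<inter> M r \<noteq> {}"
        then obtain y where "y \<in> mv \<V> x" "y \<in> M r"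
          by blast
        then have "mv \<V> x \<subseteq> M r"
          using M_compatible[OF r] mv_eq[OF x] unfolding compatible_def by metis
        then show False
          using mv_in(2)[OF x] False r by blast
      qed
      then have "mv \<V> x \<in> rest"
        using mv_in(1)[OF x] by (simp add: rest_def)
      then show ?thesis
        using mv_in(2)[OF x] by (intro UN_I[of "Inr (mv \<V> x)"]) auto
    qed
  qed
qed

lemma block_reach:
  assumes "i \<in> P <+> rest" "x \<in> block i" "y \<in> block i"
  shows "reach x y"
  using assms(1)
proof
  fix r assume "r \<in> P" "i = Inl r"
  then show ?thesis
    using reach_M assms(2,3) by simp
next
  fix V assume V: "V \<in> rest" "i = Inr V"
  then have "mv \<V> x = V" "mv \<V> y = V"
    using mv_unique[OF part] assms(2,3) by (auto simp: rest_def)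
  then show ?thesis
    by (simp add: reach_def star_def)
qed

text \<open>Together with \<open>block_reach\<close>, the nonempty blocks are exactly the classes of
  mutual reachability.\<close>

lemma reach_block:
  assumes i: "i \<in> P <+> rest" and j: "j \<in> P <+> rest" and xy: "x \<in> block i" "y \<in> block j"
    and "reach x y" "reach y x"
  shows "i = j"
proof -
  have c: "x \<in> cells L" "y \<in> cells L"
    using block_cells i j xy by blast+
  have "mv \<V> x \<subseteq> block i"
    using i
  proof
    fix r assume "r \<in> P" "i = Inl r"
    then show ?thesis
      using M_compatible xy(1) by (simp add: compatible_def)
  next
    fix V assume "V \<in> rest" "i = Inr V"
    then show ?thesis
      using mv_unique[OF part] xy(1) by (auto simp: rest_def)
  qed
  then have "y \<in> block i" if "mv \<V> x = mv \<V> y"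
    using that mv_in(2)[OF c(2)] by blast
  moreover have "y \<in> block i" if "r \<in> P" "x \<in> M r" "y \<in> M r" for r
  proof -
    have "block i \<inter> block (Inl r) \<noteq> {}" "Inl r \<in> P <+> rest"
      using that xy(1) by auto
    then have "i = Inl r"
      using block_unique i by blast
    then show ?thesis
      using that by simp
  qed
  ultimately have "y \<in> block i"
    using reach_antisym[OF c assms(5,6)] by blast
  then show ?thesis
    using block_unique i j xy by blast
qed

text \<open>\<open>height\<close> is constant on a block, so the chosen cell does not matter. For an
  empty Morse set the value is arbitrary, but no coefficient starts or ends there.\<close>

definition block_height :: "'p + 'a set \<Rightarrow> nat" where
  "block_height i = height (SOME x. x \<in> block i)"

lemma block_height_eq:
  assumes "i \<in> P <+> rest" "x \<in> block i"
  shows "block_height i = height x"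
proof -
  have "(SOME x. x \<in> block i) \<in> block i"
    using assms(2) by (rule someI)
  then show ?thesis
    unfolding block_height_def using block_reach[OF assms(1)] assms(2) height_mono
    by (meson antisym)
qed

text \<open>A nonzero coefficient gives a \<open>reach\<close>, and reaching back would put both
  cells into one block.\<close>

lemma block_height_less:
  assumes i: "i \<in> P <+> rest" and j: "j \<in> P <+> rest" "i \<noteq> j"
    and xy: "x \<in> block i" "y \<in> block j" "\<kappa>\<^bsub>L\<^esub> x y \<noteq> 0"
  shows "block_height j < block_height i"
proof -
  have c: "x \<in> cells L" "y \<in> cells L"
    using block_cells i j xy by blast+
  then have xy': "reach x y"
    using face_step xy(3) unfolding reach_def by blast
  then have "\<not> reach y x"
    using reach_block[OF i j(1) xy(1,2)] j(2) by blast
  then have "height y < height x"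
    using height_eq_imp_reach[OF c(1) xy'] by (meson not_le)
  then show ?thesis
    using block_height_eq i j xy by simp
qed

lemma rest_regular:
  assumes "V \<in> rest"
  shows "regular L V"
proof (rule ccontr)
  assume nr: "\<not> regular L V"
  have V: "V \<in> \<V>" "V \<subseteq> cells L"
    using assms rest_cells by (auto simp: rest_def)
  then have "V \<noteq> {}"
    using partition_onD3[OF part] by auto
  then obtain x where x: "x \<in> V" "x \<in> cells L"
    using V by blast
  have mv: "mv \<V> x = V"
    by (rule mv_unique[OF part V(1) x(1)])
  then have "(star L \<V> x, star L \<V> x) \<in> step\<^sup>+"
    using critical_step[OF x(2)] nr by blast
  then obtain r where "r \<in> P" "star L \<V> x \<in> M r"
    using cycle_in_M by blast
  then show False
    using star_max(1)[OF x(2)] mv assms by (auto simp: rest_def)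
qed

end

lemma (in morse) betti_rest: "V \<in> rest \<Longrightarrow> betti L V k = 0"
  unfolding betti_def by (simp add: rank_trivial_homology rest_regular[unfolded regular_def])

lemma (in morse) sum_blocks: "(\<Sum>i\<in>P <+> rest. betti L (block i) k) = morse_number L P M k"
  using finite_P finite_rest by (simp add: sum.Plus betti_rest morse_number_def)

theorem theorem9p12:
  fixes L :: "('a, 'r::ring_1_no_zero_divisors) lcomplex"
    and \<V> :: "'a set set"
    and S :: "'a set"
    and P :: "'p set"
    and M :: "'p \<Rightarrow> 'a set"
    and k :: nat
  assumes left_ore: "\<And>a b :: 'r. a \<noteq> 0 \<Longrightarrow> b \<noteq> 0 \<Longrightarrow> \<exists>c d. c * a = d * b \<and> c * a \<noteq> 0"
    and "lefschetz_complex L"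
    and "multivector_field L \<V>"
    and "invariant L \<V> (cells L)"
    and "isolated_invariant L \<V> S"
    and S_complex: "lefschetz_complex (L \<restriction> S)"
    and "morse_decomposition (L \<restriction> S) {V \<in> \<V>. V \<subseteq> S} P M"
  shows "(\<Sum>j\<le>k. (-1) ^ (k - j) * morse_number L P M j) \<ge> (\<Sum>j\<le>k. (-1) ^ (k - j) * betti L S j) \<and>
    morse_number L P M k \<ge> betti L S k"
proof -
  let ?K = "L \<restriction> S" and ?\<W> = "{V \<in> \<V>. V \<subseteq> S}"
  interpret X: mvf L \<V>
    using assms(2,3) by unfold_locales
  have "invariant L \<V> S"
    using assms(5) by (simp add: isolated_invariant_def)
  then have "compatible L \<V> S"
    using invariant_compatible[OF X.part] X.star_max(1) by blast
  then have field: "multivector_field ?K ?\<W>"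
    using multivector_field_restrict assms(2,3) S_complex by blast
  obtain R where R: "finite P" "partial_order_on P R" "disjoint_family_on M P"
    "\<forall>r\<in>P. isolated_invariant ?K ?\<W> (M r)"
    "\<forall>\<phi>. full_solution ?K ?\<W> \<phi> \<longrightarrow> (\<exists>r\<in>P. \<exists>r'\<in>P. (r, r') \<in> R \<and>
       alpha_limit ?K ?\<W> \<phi> \<subseteq> M r' \<and> omega_limit ?K ?\<W> \<phi> \<subseteq> M r)"
    "\<forall>\<phi>. \<forall>r\<in>P. full_solution ?K ?\<W> \<phi> \<and>
       alpha_limit ?K ?\<W> \<phi> \<union> omega_limit ?K ?\<W> \<phi> \<subseteq> M r \<longrightarrow> range \<phi> \<subseteq> M r"
    using assms(7) unfolding morse_decomposition_def by blast
  interpret Y: morse ?K ?\<W> P M R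
    using S_complex field R by unfold_locales blast+
  have ore: "left_ore TYPE('r)"
    using left_ore by (simp add: left_ore_def)
  have fin: "finite (P <+> Y.rest)"
    using Y.finite_P Y.finite_rest by simp
  \<comment> \<open>Restriction only overwrites the set of cells, so a Morse set has the same
    homology whether it is cut out of \<open>S\<close> or directly out of the whole complex.\<close>
  have K: "cells ?K = S" "betti ?K A j = betti L A j" "morse_number ?K P M j = morse_number L P M j"
    for A j
    by (simp_all add: subcomplex_def betti_def morse_number_def)
  have "(\<Sum>j\<le>k. (-1) ^ (k - j) * betti ?K (cells ?K) j) \<le>
      (\<Sum>j\<le>k. (-1) ^ (k - j) * (\<Sum>i\<in>P <+> Y.rest. betti ?K (Y.block i) j))"
    by (rule morse_inequalities_blocks(1)[OF ore S_complex fin Y.block_disjoint Y.block_union])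
      (rule Y.block_height_less)
  moreover have "betti ?K (cells ?K) k \<le> (\<Sum>i\<in>P <+> Y.rest. betti ?K (Y.block i) k)"
    by (rule morse_inequalities_blocks(2)[OF ore S_complex fin Y.block_disjoint Y.block_union])
      (rule Y.block_height_less)
  ultimately show ?thesis
    unfolding Y.sum_blocks unfolding K by simp
qed

end
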